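(* Let $X$ be a metrizable space and $G$ an abelian group. Then $$D_{\infty}^{f}(X;G)=D_{f}(\beta X\setminus X;G).$$
   Context: Conventions. Normal spaces are $T_1$ (hence Hausdorff). $\beta X$ is the Stone–Čech compactification. A closed pair $(X,A)$ is a space $X$ with a closed subset $A$. An indexed family $\alpha=\{\alpha_v\}_{v\in(V_\alpha,V_\alpha^A)}$ of subsets of $X$ is a function $v\mapsto\alpha_v$ on an index set $V_\alpha$ together with a distinguished subset $V_\alpha^A\subseteq V_\alpha$; it is finite if $V_\alpha$ is finite. Border covers. A border cover of a closed pair $(X,A)$ with $X$ normal is a finite indexed family $\alpha=\{\alpha_v\}_{v\in(V_\alpha,V_\alpha^A)}$ of open subsets of $X$ for which there is a compact $K_\alpha\subseteq X$ with $X\setminus K_\alpha=\bigcup_{v\in V_\alpha}\alpha_v$ and $A\setminus K_\alpha\subseteq\bigcup_{v\in V_\alpha^A}\alpha_v$. The set of border covers is $\mathrm{cov}_\infty(X,A)$, directed by $\alpha\le\beta$ iff there is a refinement projection $p:V_\beta\to V_\alpha$ with $p(V_\beta^A)\subseteq V_\alpha^A$ and $\beta_v\subseteq\alpha_{p(v)}$ for all $v\in V_\beta$. Border cohomology. For $\alpha\in\mathrm{cov}_\infty(X,A)$ let $X_\alpha$ be the nerve: its simplexes are the nonempty finite $s\subseteq V_\alpha$ with $\mathrm{Car}_\alpha(s)=\bigcap_{v\in s}\alpha_v\neq\emptyset$; $A_\alpha$ is the subcomplex of simplexes $s\subseteq V_\alpha^A$ with $\mathrm{Car}_\alpha(s)\cap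 A\neq\emptyset$. Refinement projections induce simplicial maps $(X_\beta,A_\beta)\to(X_\alpha,A_\alpha)$, any two contiguous, hence well-defined homomorphisms in simplicial cohomology. Put $\hat H^n_\infty(X,A;G)=\varinjlim_{\alpha\in\mathrm{cov}_\infty(X,A)}H^n(X_\alpha,A_\alpha;G)$. Čech cohomology based on finite open covers. For a closed pair $(Y,B)$, $\hat H^n_f(Y,B;G)$ is defined in the same way but over all finite open covers of $(Y,B)$, i.e. finite families $\{\alpha_v\}_{v\in(V_\alpha,V_\alpha^B)}$ of open subsets of $Y$ with $\bigcup_{v\in V_\alpha}\alpha_v=Y$ and $B\subseteq\bigcup_{v\in V_\alpha^B}\alpha_v$. Border large cohomological dimension. For a normal space $X$, $D^f_\infty(X;G)\in\{0,1,2,\dots\}\cup\{+\infty\}$ is the largest integer $n$ such that $\hat H^n_\infty(X,A;G)\ne0$ for some closed $A\subseteq X$ ($+\infty$ if there are arbitrarily large such $n$, and $0$ if there are none). Large cohomological dimension. $D_f(Y;G)\in\{0,1,2,\dots\}\cup\{+\infty\}$ is the largest integer $n$ such that $\hat H^n_f(Y,B;G)\neq0$ for some closed $B\subseteq Y$, with the same conventions. *)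

theory Defs
  imports
    "HOL-Analysis.Analysis"
    "HOL-Algebra.Product_Groups"
    "HOL-Algebra.FiniteProduct"
begin

section \<open>Direct limits of directed systems of groups\<close>

text \<open>
  A system consists of an index set \<open>I\<close>, directed by the preorder \<open>prec\<close>, groups \<open>H i\<close>, and
  homomorphisms \<open>\<phi> i j : H i \<rightarrow> H j\<close> for \<open>prec i j\<close>.  The limit is the usual quotient of the disjoint
  union of the \<open>H i\<close>.  In a directed system all the classes that are united in the definitions of
  the product and of the unit coincide.
\<close>

definition direct_limit_rel ::
  "'i set \<Rightarrow> ('i \<Rightarrow> 'i \<Rightarrow> bool) \<Rightarrow> ('i \<Rightarrow> 'h monoid) \<Rightarrow> ('i \<Rightarrow> 'i \<Rightarrow> 'h \<Rightarrow> 'h) \<Rightarrow> (('i \<times> 'h) \<times> ('i \<times> 'h)) set"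
  where
  "direct_limit_rel I prec H \<phi> =
     {((i, x), (j, y)) | i x j y.
        i \<in> I \<and> x \<in> carrier (H i) \<and> j \<in> I \<and> y \<in> carrier (H j) \<and>
        (\<exists>k\<in>I. prec i k \<and> prec j k \<and> \<phi> i k x = \<phi> j k y)}"

definition direct_limit ::
  "'i set \<Rightarrow> ('i \<Rightarrow> 'i \<Rightarrow> bool) \<Rightarrow> ('i \<Rightarrow> 'h monoid) \<Rightarrow> ('i \<Rightarrow> 'i \<Rightarrow> 'h \<Rightarrow> 'h) \<Rightarrow> ('i \<times> 'h) set monoid"
  where
  "direct_limit I prec H \<phi> =
     (let R = direct_limit_rel I prec H \<phi> in
      \<lparr>carrier = (SIGMA i:I. carrier (H i)) // R,
       monoid.mult = (\<lambda>P Q. \<Union>{R `` {(k, \<phi> i k x \<otimes>\<^bsub>H k\<^esub> \<phi> j k y)} | i x j y k.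
                         (i, x) \<in> P \<and> (j, y) \<in> Q \<and> k \<in> I \<and> prec i k \<and> prec j k}),
       one = (\<Union>i\<in>I. R `` {(i, \<one>\<^bsub>H i\<^esub>)})\<rparr>)"

section \<open>Simplicial cohomology of a pair of complexes\<close>

text \<open>
  A simplicial complex \<open>K\<close> is represented by its set of simplexes, which are nonempty finite sets of
  vertices.  As in Eilenberg and Steenrod, cohomology is computed from ordered cochains: the
  \<open>n\<close>-cochains are the homomorphisms to \<open>G\<close> from the free abelian group on the sequences
  \<open>v\<^sub>0, \<dots>, v\<^sub>n\<close> of vertices, repetitions allowed, that span a simplex of \<open>K\<close>.
  They are represented by their values on these generators.
  The abelian coefficient group \<open>G\<close> is written multiplicatively.
\<close>

definition ordered_simplexes :: "'v set set \<Rightarrow> nat \<Rightarrow> 'v list set" where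
  "ordered_simplexes K n = {vs. length vs = Suc n \<and> set vs \<in> K}"

definition face :: "nat \<Rightarrow> 'v list \<Rightarrow> 'v list" where
  "face i vs = take i vs @ drop (Suc i) vs"

text \<open>The cochains of the pair \<open>(K, L)\<close> are the cochains of \<open>K\<close> that vanish on \<open>L\<close>.\<close>

definition cochain_group ::
  "'v set set \<Rightarrow> 'v set set \<Rightarrow> ('g, 'm) monoid_scheme \<Rightarrow> nat \<Rightarrow> ('v list \<Rightarrow> 'g) monoid" where
  "cochain_group K L G n =
     (product_group (ordered_simplexes K n) (\<lambda>_. G))
       \<lparr>carrier := {c \<in> carrier (product_group (ordered_simplexes K n) (\<lambda>_. G)).
                     \<forall>vs \<in> ordered_simplexes L n. c vs = \<one>\<^bsub>G\<^esub>}\<rparr>"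

text \<open>The additive form is \<open>(\<delta> c) (v\<^sub>0, \<dots>, v\<^sub>n\<^sub>+\<^sub>1) = \<Sum>\<^sub>i (-1)\<^sup>i c (v\<^sub>0, \<dots>, v\<^sub>i omitted, \<dots>, v\<^sub>n\<^sub>+\<^sub>1)\<close>.\<close>

definition coboundary ::
  "'v set set \<Rightarrow> ('g, 'm) monoid_scheme \<Rightarrow> nat \<Rightarrow> ('v list \<Rightarrow> 'g) \<Rightarrow> ('v list \<Rightarrow> 'g)" where
  "coboundary K G n c =
     (\<lambda>vs \<in> ordered_simplexes K (Suc n).
        \<Otimes>\<^bsub>G\<^esub>i\<in>{0..Suc n}. c (face i vs) [^]\<^bsub>G\<^esub> ((-1) ^ i :: int))"

definition cocycles ::
  "'v set set \<Rightarrow> 'v set set \<Rightarrow> ('g, 'm) monoid_scheme \<Rightarrow> nat \<Rightarrow> ('v list \<Rightarrow> 'g) set" where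
  "cocycles K L G n = kernel (cochain_group K L G n) (cochain_group K L G (Suc n)) (coboundary K G n)"

definition coboundaries ::
  "'v set set \<Rightarrow> 'v set set \<Rightarrow> ('g, 'm) monoid_scheme \<Rightarrow> nat \<Rightarrow> ('v list \<Rightarrow> 'g) set" where
  "coboundaries K L G n =
     (case n of 0 \<Rightarrow> {\<one>\<^bsub>cochain_group K L G 0\<^esub>}
      | Suc m \<Rightarrow> coboundary K G m ` carrier (cochain_group K L G m))"

definition simplicial_cohomology ::
  "'v set set \<Rightarrow> 'v set set \<Rightarrow> ('g, 'm) monoid_scheme \<Rightarrow> nat \<Rightarrow> ('v list \<Rightarrow> 'g) set monoid" where
  "simplicial_cohomology K L G n =
     (cochain_group K L G n)\<lparr>carrier := cocycles K L G n\<rparr> Mod coboundaries K L G n"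

definition cochain_pullback ::
  "'w set set \<Rightarrow> nat \<Rightarrow> ('w \<Rightarrow> 'v) \<Rightarrow> ('v list \<Rightarrow> 'g) \<Rightarrow> ('w list \<Rightarrow> 'g)" where
  "cochain_pullback K' n p c = (\<lambda>ws \<in> ordered_simplexes K' n. c (map p ws))"

text \<open>
  The homomorphism into \<open>H\<^sup>n(K', L'; G)\<close> induced by a simplicial map \<open>p : (K', L') \<rightarrow> (K, L)\<close>.  It
  sends the class \<open>z\<close> of a cocycle \<open>c\<close>, which is a coset, to the coset of the pullback of \<open>c\<close>.
\<close>

definition cohomology_map ::
  "'w set set \<Rightarrow> 'w set set \<Rightarrow> ('g, 'm) monoid_scheme \<Rightarrow> nat \<Rightarrow> ('w \<Rightarrow> 'v) \<Rightarrow>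
     ('v list \<Rightarrow> 'g) set \<Rightarrow> ('w list \<Rightarrow> 'g) set" where
  "cohomology_map K' L' G n p z =
     coboundaries K' L' G n <#>\<^bsub>cochain_group K' L' G n\<^esub> cochain_pullback K' n p ` z"

section \<open>Indexed families, refinement and nerves\<close>

text \<open>
  A finite family indexed by a pair of sets.  Since every finite index set is in bijection with a
  set of natural numbers, indices are taken from \<open>nat\<close>; this makes the covers form a set.  The
  values of \<open>part\<close> outside \<open>index\<close> play no role.
\<close>

record 'a family =
  index :: "nat set"
  subindex :: "nat set"
  part :: "nat \<Rightarrow> 'a set"

definition finite_family :: "'a family \<Rightarrow> bool" where
  "finite_family \<alpha> \<longleftrightarrow> finite (index \<alpha>) \<and> subindex \<alpha> \<subseteq> index \<alpha>"

definition refinement_projection :: "'a family \<Rightarrow> 'a family \<Rightarrow> (nat \<Rightarrow> nat) \<Rightarrow> bool" where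
  "refinement_projection \<alpha> \<beta> p \<longleftrightarrow>
     p ` index \<beta> \<subseteq> index \<alpha> \<and> p ` subindex \<beta> \<subseteq> subindex \<alpha> \<and>
     (\<forall>v\<in>index \<beta>. part \<beta> v \<subseteq> part \<alpha> (p v))"

definition refined_by :: "'a family \<Rightarrow> 'a family \<Rightarrow> bool" where
  "refined_by \<alpha> \<beta> \<longleftrightarrow> (\<exists>p. refinement_projection \<alpha> \<beta> p)"

definition Car :: "'a family \<Rightarrow> nat set \<Rightarrow> 'a set" where
  "Car \<alpha> s = (\<Inter>v\<in>s. part \<alpha> v)"

definition nerve :: "'a family \<Rightarrow> nat set set" where
  "nerve \<alpha> = {s. s \<noteq> {} \<and> finite s \<and> s \<subseteq> index \<alpha> \<and> Car \<alpha> s \<noteq> {}}"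

definition subnerve :: "'a set \<Rightarrow> 'a family \<Rightarrow> nat set set" where
  "subnerve A \<alpha> = {s \<in> nerve \<alpha>. s \<subseteq> subindex \<alpha> \<and> Car \<alpha> s \<inter> A \<noteq> {}}"

text \<open>
  The direct limit of the cohomology of the nerves, over a set of covers directed by refinement.
  The transition maps do not depend on the choice of refinement projections, since any two of
  these are contiguous.
\<close>

definition refinement_map ::
  "'a set \<Rightarrow> ('g, 'm) monoid_scheme \<Rightarrow> nat \<Rightarrow> 'a family \<Rightarrow> 'a family \<Rightarrow>
     (nat list \<Rightarrow> 'g) set \<Rightarrow> (nat list \<Rightarrow> 'g) set" where
  "refinement_map A G n \<alpha> \<beta> =
     cohomology_map (nerve \<beta>) (subnerve A \<beta>) G n (SOME p. refinement_projection \<alpha> \<beta> p)"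

definition limit_cohomology ::
  "'a family set \<Rightarrow> 'a set \<Rightarrow> ('g, 'm) monoid_scheme \<Rightarrow> nat \<Rightarrow>
     ('a family \<times> (nat list \<Rightarrow> 'g) set) set monoid" where
  "limit_cohomology \<C> A G n =
     direct_limit \<C> refined_by
       (\<lambda>\<alpha>. simplicial_cohomology (nerve \<alpha>) (subnerve A \<alpha>) G n)
       (refinement_map A G n)"

section \<open>Border cohomology and Cech cohomology based on finite open covers\<close>

definition border_covers :: "'a topology \<Rightarrow> 'a set \<Rightarrow> 'a family set" where
  "border_covers X A =
     {\<alpha>. finite_family \<alpha> \<and> (\<forall>v\<in>index \<alpha>. openin X (part \<alpha> v)) \<and>
         (\<exists>K. compactin X K \<and>
              topspace X - K = (\<Union>v\<in>index \<alpha>. part \<alpha> v) \<and>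
              A - K \<subseteq> (\<Union>v\<in>subindex \<alpha>. part \<alpha> v))}"

definition finite_open_covers :: "'a topology \<Rightarrow> 'a set \<Rightarrow> 'a family set" where
  "finite_open_covers Y B =
     {\<alpha>. finite_family \<alpha> \<and> (\<forall>v\<in>index \<alpha>. openin Y (part \<alpha> v)) \<and>
         (\<Union>v\<in>index \<alpha>. part \<alpha> v) = topspace Y \<and>
         B \<subseteq> (\<Union>v\<in>subindex \<alpha>. part \<alpha> v)}"

definition border_cohomology ::
  "'a topology \<Rightarrow> 'a set \<Rightarrow> ('g, 'm) monoid_scheme \<Rightarrow> nat \<Rightarrow>
     ('a family \<times> (nat list \<Rightarrow> 'g) set) set monoid" where
  "border_cohomology X A G n = limit_cohomology (border_covers X A) A G n"

definition cech_cohomology ::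
  "'a topology \<Rightarrow> 'a set \<Rightarrow> ('g, 'm) monoid_scheme \<Rightarrow> nat \<Rightarrow>
     ('a family \<times> (nat list \<Rightarrow> 'g) set) set monoid" where
  "cech_cohomology Y B G n = limit_cohomology (finite_open_covers Y B) B G n"

section \<open>Large cohomological dimensions\<close>

text \<open>In \<open>enat\<close>, the supremum of the empty set is \<open>0\<close> and that of an unbounded set is \<open>\<infinity>\<close>.\<close>

definition border_large_cohomological_dim ::
  "'a topology \<Rightarrow> ('g, 'm) monoid_scheme \<Rightarrow> enat" where
  "border_large_cohomological_dim X G =
     Sup {enat n | n. \<exists>A. closedin X A \<and>
            carrier (border_cohomology X A G n) \<noteq> {\<one>\<^bsub>border_cohomology X A G n\<^esub>}}"

definition large_cohomological_dim ::
  "'a topology \<Rightarrow> ('g, 'm) monoid_scheme \<Rightarrow> enat" where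
  "large_cohomological_dim Y G =
     Sup {enat n | n. \<exists>B. closedin Y B \<and>
            carrier (cech_cohomology Y B G n) \<noteq> {\<one>\<^bsub>cech_cohomology Y B G n\<^esub>}}"

section \<open>The Stone-Cech compactification\<close>

text \<open>
  The closure of the image of \<open>X\<close> under the evaluation map into the cube with one factor
  \<open>[0,1]\<close> for each continuous function from \<open>X\<close> to \<open>[0,1]\<close>.
\<close>

definition unit_functions :: "'a topology \<Rightarrow> ('a \<Rightarrow> real) set" where
  "unit_functions X =
     {f \<in> extensional (topspace X). continuous_map X (top_of_set {0..1}) f}"

definition unit_cube :: "'a topology \<Rightarrow> (('a \<Rightarrow> real) \<Rightarrow> real) topology" where
  "unit_cube X = product_topology (\<lambda>_. top_of_set {0..1}) (unit_functions X)"

definition stone_cech_embed :: "'a topology \<Rightarrow> 'a \<Rightarrow> ('a \<Rightarrow> real) \<Rightarrow> real" where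
  "stone_cech_embed X x = (\<lambda>f \<in> unit_functions X. f x)"

definition stone_cech :: "'a topology \<Rightarrow> (('a \<Rightarrow> real) \<Rightarrow> real) topology" where
  "stone_cech X =
     subtopology (unit_cube X) (unit_cube X closure_of (stone_cech_embed X ` topspace X))"

definition stone_cech_remainder :: "'a topology \<Rightarrow> (('a \<Rightarrow> real) \<Rightarrow> real) topology" where
  "stone_cech_remainder X =
     subtopology (stone_cech X) (topspace (stone_cech X) - stone_cech_embed X ` topspace X)"

lemma compact_space_stone_cech: "compact_space (stone_cech X)"
  unfolding stone_cech_def
  by (intro compact_space_subtopology closedin_compact_space)
     (auto simp: unit_cube_def compact_space_product_topology compact_space_subtopology closedin_compact_space)

lemma Hausdorff_space_stone_cech: "Hausdorff_space (stone_cech X)"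
  unfolding stone_cech_def unit_cube_def
  by (intro Hausdorff_space_subtopology) (auto simp: Hausdorff_space_product_topology Hausdorff_space_subtopology)

lemma unit_functions_eq:
  "unit_functions X =
     mspace (submetric (cfunspace X euclidean_metric) {f. f \<in> topspace X \<rightarrow> {0..1::real}})"
proof -
  have "bounded (f ` topspace X)" if "f \<in> topspace X \<rightarrow> {0..1::real}" for f :: "'a \<Rightarrow> real"
    by (rule bounded_subset[of "{0..1}"]) (use that in auto)
  then show ?thesis
    by (auto simp: unit_functions_def continuous_map_in_subtopology Met_TC.mbounded_def image_subset_iff Pi_iff)
qed

lemma embedding_map_stone_cech:
  assumes "completely_regular_space X" "Hausdorff_space X"
  shows "embedding_map X (stone_cech X) (stone_cech_embed X)"
proof -
  have e: "embedding_map X (unit_cube X) (stone_cech_embed X)"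
    using completely_regular_space_cube_embedding_explicit [OF assms]
    by (simp only: flip: unit_functions_eq)
       (simp add: unit_cube_def stone_cech_embed_def[abs_def])
  show ?thesis unfolding stone_cech_def embedding_map_in_subtopology
    using e closure_of_subset[of "stone_cech_embed X ` topspace X" "unit_cube X"]
      homeomorphic_imp_continuous_map[OF e[unfolded embedding_map_def]]
    by (auto simp: continuous_map_in_subtopology dest!: continuous_map_image_subset_topspace)
qed

end

theory Submission
  imports Defs
begin

text \<open>
  Let \<open>S\<close> be the copy of \<open>X\<close> in \<open>T = \<beta>X\<close>, and for open \<open>U \<subseteq> S\<close> let \<open>Ext U\<close> be the largest open subset of
  \<open>T\<close> with trace \<open>U\<close> on \<open>S\<close>.  Since disjoint closed sets of \<open>S\<close> have disjoint closures in \<open>T\<close>, a border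
  cover \<open>\<alpha>\<close> of \<open>(S, A)\<close> yields the finite open cover \<open>Ext \<alpha> - S\<close> of \<open>(T - S, cl A - S)\<close>, whose nerves are
  contained in those of \<open>\<alpha>\<close>.  Conversely a finite open cover of \<open>(T - S, B)\<close> is the trace of open sets
  \<open>W\<close> of \<open>T\<close> that miss only a compact subset \<open>K\<close> of \<open>S\<close>.  As \<open>S\<close> is metrizable, \<open>K\<close> is a \<open>G\<^sub>\<delta>\<close> set in \<open>T\<close>, so that
  \<open>T - K\<close> is normal; shrinking \<open>W\<close> there and enlarging \<open>K\<close> yields a border cover whose nerves are
  contained in those of the given cover.

  A direct limit of cohomology groups of nerves is nontrivial iff there is a cocycle on one nerve that
  does not become a coboundary on any refinement.  The two constructions, which preserve indices and
  refinement projections, carry such a cocycle from one system to the other.  Not every closed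
  \<open>B \<subseteq> T - S\<close> is of the form \<open>cl A - S\<close>, but a cocycle for \<open>B\<close> extends over a closed neighbourhood of \<open>B\<close>,
  and the trace of this neighbourhood on \<open>S\<close> serves as \<open>A\<close>.
\<close>

section \<open>Contiguous simplicial maps\<close>

primrec alternating_prod :: "('g, 'm) monoid_scheme \<Rightarrow> 'v list \<Rightarrow> ('v list \<Rightarrow> 'g) \<Rightarrow> 'g" where
  "alternating_prod G [] = (\<lambda>f. \<one>\<^bsub>G\<^esub>)"
| "alternating_prod G (v # vs) =
     (\<lambda>f. f vs \<otimes>\<^bsub>G\<^esub> inv\<^bsub>G\<^esub> alternating_prod G vs (\<lambda>us. f (v # us)))"

text \<open>\<open>prism\<close> evaluates a cochain on the prism operator between the simplicial maps \<open>p\<close> and \<open>q\<close>, and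
  \<open>alternating_prod\<close> evaluates it on the boundary of a list.  Both recursions take off the first vertex;
  the boundary is augmented (that of a single vertex is the empty list), which makes the homotopy
  formula hold for all lists and provable by induction.\<close>

primrec prism :: "('g, 'm) monoid_scheme \<Rightarrow> ('w \<Rightarrow> 'v) \<Rightarrow> ('w \<Rightarrow> 'v) \<Rightarrow> 'w list \<Rightarrow> ('v list \<Rightarrow> 'g) \<Rightarrow> 'g" where
  "prism G p q [] = (\<lambda>f. \<one>\<^bsub>G\<^esub>)"
| "prism G p q (w # ws) =
     (\<lambda>f. f (p w # q w # map q ws) \<otimes>\<^bsub>G\<^esub> inv\<^bsub>G\<^esub> prism G p q ws (\<lambda>us. f (p w # us)))"

lemma (in comm_monoid) m_exchange:
  "\<lbrakk>a \<in> carrier G; b \<in> carrier G; c \<in> carrier G; d \<in> carrier G\<rbrakk> \<Longrightarrow> (a \<otimes> b) \<otimes> (c \<otimes> d) = (a \<otimes> c) \<otimes> (b \<otimes> d)"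
  by (simp add: m_ac)

context comm_group
begin

lemma alternating_prod_closed [simp]:
  "(\<And>us. f us \<in> carrier G) \<Longrightarrow> alternating_prod G vs f \<in> carrier G"
  by (induction vs arbitrary: f) auto

lemma prism_closed [simp]: "(\<And>us. f us \<in> carrier G) \<Longrightarrow> prism G p q ws f \<in> carrier G"
  by (induction ws arbitrary: f) auto

lemma alternating_prod_mult:
  "\<lbrakk>\<And>us. f us \<in> carrier G; \<And>us. g us \<in> carrier G\<rbrakk> \<Longrightarrow>
   alternating_prod G vs (\<lambda>us. f us \<otimes> g us) = alternating_prod G vs f \<otimes> alternating_prod G vs g"
proof (induction vs arbitrary: f g)
  case (Cons v vs)
  show ?case
    using Cons.prems by (simp add: Cons.IH inv_mult m_exchange)
qed simp

lemma alternating_prod_inv: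
  "(\<And>us. f us \<in> carrier G) \<Longrightarrow> alternating_prod G vs (\<lambda>us. inv (f us)) = inv (alternating_prod G vs f)"
proof (induction vs arbitrary: f)
  case (Cons v vs)
  show ?case
    using Cons.prems by (simp add: Cons.IH inv_mult)
qed simp

lemma prism_mult:
  "\<lbrakk>\<And>us. f us \<in> carrier G; \<And>us. g us \<in> carrier G\<rbrakk> \<Longrightarrow>
   prism G p q ws (\<lambda>us. f us \<otimes> g us) = prism G p q ws f \<otimes> prism G p q ws g"
proof (induction ws arbitrary: f g)
  case (Cons v vs)
  show ?case
    using Cons.prems by (simp add: Cons.IH inv_mult m_exchange)
qed simp

lemma prism_inv:
  "(\<And>us. f us \<in> carrier G) \<Longrightarrow> prism G p q ws (\<lambda>us. inv (f us)) = inv (prism G p q ws f)"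
proof (induction ws arbitrary: f)
  case (Cons v vs)
  show ?case
    using Cons.prems by (simp add: Cons.IH inv_mult)
qed simp

lemma alternating_prod_map:
  "alternating_prod G (map q ws) f = alternating_prod G ws (\<lambda>us. f (map q us))"
  by (induction ws arbitrary: f) auto

text \<open>Chain homotopy identity: the first factor is \<open>f\<close> on the boundary of the
  prism over \<open>ws\<close>, the second is \<open>f\<close> on the prism over the boundary of
  \<open>ws\<close>, and together they leave top minus bottom. Splitting off the first vertex
  requires the statement for \<open>?fp\<close> in place of \<open>f\<close>.\<close>

lemma prism_homotopy:
  assumes "\<And>us. f us \<in> carrier G"
  shows "prism G p q ws (\<lambda>us. alternating_prod G us f) \<otimes> alternating_prod G ws (\<lambda>us. prism G p q us f)
       = f (map q ws) \<otimes> inv (f (map p ws))"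
  using assms
proof (induction ws arbitrary: f)
  case Nil
  then show ?case by simp
next
  case (Cons w ws)
  note [simp] = Cons.prems
  let ?fp = "\<lambda>us. f (p w # us)"
  let ?a = "f (q w # map q ws)"
  let ?b = "f (p w # map q ws)"
  let ?c = "alternating_prod G ws (\<lambda>us. f (p w # q w # map q us))"
  let ?D = "prism G p q ws f"
  let ?H = "prism G p q ws (\<lambda>us. alternating_prod G us ?fp)"
  let ?K = "alternating_prod G ws (\<lambda>us. prism G p q us ?fp)"
  have IH: "?H \<otimes> ?K = ?b \<otimes> inv (f (p w # map p ws))"
    using Cons.IH[of ?fp] by simp
  have "prism G p q (w # ws) (\<lambda>us. alternating_prod G us f)
      = (?a \<otimes> inv (?b \<otimes> inv ?c)) \<otimes> inv (?D \<otimes> inv ?H)"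
    by (simp add: alternating_prod_map prism_mult prism_inv)
  moreover have "alternating_prod G (w # ws) (\<lambda>us. prism G p q us f) = ?D \<otimes> inv (?c \<otimes> inv ?K)"
    by (simp add: alternating_prod_mult alternating_prod_inv)
  \<comment> \<open>\<open>c\<close> and \<open>D\<close> occur in both factors with opposite signs
    and cancel; \<open>H\<close> and \<open>K\<close> are the two factors for \<open>ws\<close> and
    \<open>?fp\<close>, to which the induction hypothesis applies.\<close>
  moreover have "(a \<otimes> inv (b \<otimes> inv c)) \<otimes> inv (D \<otimes> inv H) \<otimes> (D \<otimes> inv (c \<otimes> inv K)) = a \<otimes> inv b \<otimes> (H \<otimes> K)"
    if [simp]: "a \<in> carrier G" "b \<in> carrier G" "c \<in> carrier G" "D \<in> carrier G" "H \<in> carrier G" "K \<in> carrier G"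
    for a b c D H K
  proof -
    have "(a \<otimes> inv (b \<otimes> inv c)) \<otimes> inv (D \<otimes> inv H) \<otimes> (D \<otimes> inv (c \<otimes> inv K))
        = (a \<otimes> inv b \<otimes> (H \<otimes> K)) \<otimes> (c \<otimes> inv c) \<otimes> (D \<otimes> inv D)"
      by (simp only: inv_mult inv_inv inv_closed m_closed that m_ac)
    then show ?thesis by simp
  qed
  ultimately have "prism G p q (w # ws) (\<lambda>us. alternating_prod G us f) \<otimes> alternating_prod G (w # ws) (\<lambda>us. prism G p q us f)
     = ?a \<otimes> inv ?b \<otimes> (?b \<otimes> inv (f (p w # map p ws)))"
    by (simp only: IH Cons.prems prism_closed alternating_prod_closed)
  also have "\<dots> = ?a \<otimes> inv (f (p w # map p ws))"
    by (simp add: m_assoc flip: m_assoc[of "inv ?b"])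
  finally show ?case by simp
qed

lemma finprod_inv:
  assumes "finite I" "\<And>i. i \<in> I \<Longrightarrow> f i \<in> carrier G"
  shows "(\<Otimes>i\<in>I. inv (f i)) = inv (\<Otimes>i\<in>I. f i)"
  using assms by (induction I) (simp_all add: Pi_iff inv_mult)

text \<open>Links the recursion to the formula for \<open>coboundary\<close>: omitting the first
  vertex gives \<open>f vs\<close>, and every other face of \<open>v # vs\<close> is
  \<open>v\<close> followed by a face of \<open>vs\<close> whose index is one lower, hence of
  opposite sign.\<close>

lemma alternating_prod_eq_finprod:
  "(\<And>us. f us \<in> carrier G) \<Longrightarrow>
   (\<Otimes>i\<in>{..<length vs}. f (face i vs) [^] ((-1) ^ i :: int)) = alternating_prod G vs f"
proof (induction vs arbitrary: f)
  case (Cons v vs)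
  note [simp] = Cons.prems
  have "{..<length (v # vs)} = insert 0 (Suc ` {..<length vs})"
    by (simp add: lessThan_Suc_eq_insert_0)
  then have "(\<Otimes>i\<in>{..<length (v # vs)}. f (face i (v # vs)) [^] ((-1) ^ i :: int)) =
      f vs \<otimes> (\<Otimes>i\<in>Suc ` {..<length vs}. f (face i (v # vs)) [^] ((-1) ^ i :: int))"
    by (simp add: face_def int_pow_1)
  also have "(\<Otimes>i\<in>Suc ` {..<length vs}. f (face i (v # vs)) [^] ((-1) ^ i :: int)) =
      (\<Otimes>i\<in>{..<length vs}. inv (f (v # face i vs) [^] ((-1) ^ i :: int)))"
    by (subst finprod_reindex) (auto simp: face_def int_pow_neg)
  also have "\<dots> = inv (alternating_prod G vs (\<lambda>us. f (v # us)))"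
    by (subst finprod_inv) (simp_all add: Cons.IH[of "\<lambda>us. f (v # us)"])
  finally show ?case by simp
qed simp

end

section \<open>Relative cochain groups and the coboundary homomorphism\<close>

definition simplex_family :: "'v set set \<Rightarrow> bool" where
  "simplex_family K \<longleftrightarrow> (\<forall>s\<in>K. \<forall>t\<subseteq>s. t \<noteq> {} \<longrightarrow> t \<in> K)"

lemma ordered_simplexes_face:
  assumes "simplex_family K" "vs \<in> ordered_simplexes K (Suc n)" "i \<le> Suc n"
  shows "face i vs \<in> ordered_simplexes K n"
proof -
  have "length (face i vs) = Suc n" using assms by (auto simp: face_def ordered_simplexes_def)
  moreover have "set (face i vs) \<subseteq> set vs"
    by (auto simp: face_def dest: in_set_takeD in_set_dropD)
  moreover have "set vs \<in> K" using assms by (auto simp: ordered_simplexes_def)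
  moreover have "set (face i vs) \<noteq> {}" using calculation(1) by (metis length_0_conv nat.distinct(1) set_empty)
  ultimately show ?thesis using assms by (auto simp: simplex_family_def ordered_simplexes_def)
qed

lemma ordered_simplexes_mono: "L \<subseteq> K \<Longrightarrow> ordered_simplexes L n \<subseteq> ordered_simplexes K n"
  by (auto simp: ordered_simplexes_def)

lemma carrier_cochain_group:
  "carrier (cochain_group K L G n) =
   {c \<in> ordered_simplexes K n \<rightarrow>\<^sub>E carrier G. \<forall>vs\<in>ordered_simplexes L n. c vs = \<one>\<^bsub>G\<^esub>}"
  by (simp add: cochain_group_def)

lemma mult_cochain_group:
  "c \<otimes>\<^bsub>cochain_group K L G n\<^esub> d = (\<lambda>vs\<in>ordered_simplexes K n. c vs \<otimes>\<^bsub>G\<^esub> d vs)"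
  by (simp add: cochain_group_def)

lemma one_cochain_group: "\<one>\<^bsub>cochain_group K L G n\<^esub> = (\<lambda>vs\<in>ordered_simplexes K n. \<one>\<^bsub>G\<^esub>)"
  by (simp add: cochain_group_def)

text \<open>Cochains are undefined off the ordered simplexes, while the laws of
  \<open>alternating_prod\<close> and \<open>prism\<close> assume values in \<open>carrier G\<close>
  on all lists.\<close>

definition extend_by_one :: "('g, 'm) monoid_scheme \<Rightarrow> 'v list set \<Rightarrow> ('v list \<Rightarrow> 'g) \<Rightarrow> 'v list \<Rightarrow> 'g" where
  "extend_by_one G S c = (\<lambda>vs. if vs \<in> S then c vs else \<one>\<^bsub>G\<^esub>)"

context comm_group
begin

text \<open>A subgroup of a power of \<open>G\<close>: as \<open>L \<subseteq> K\<close>, vanishing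
  on \<open>L\<close> is a condition on coordinates of that power.\<close>

lemma comm_group_cochain_group: "comm_group (cochain_group K L G n)" if "L \<subseteq> K"
proof -
  let ?P = "product_group (ordered_simplexes K n) (\<lambda>_. G)"
  interpret P: group ?P by simp
  have "subgroup (carrier (cochain_group K L G n)) ?P"
  proof (rule P.subgroupI)
    show "carrier (cochain_group K L G n) \<noteq> {}"
      using ordered_simplexes_mono[OF that, of n]
      by (auto simp: carrier_cochain_group subset_iff intro!: exI[of _ "\<lambda>vs\<in>ordered_simplexes K n. \<one>"])
  qed (use ordered_simplexes_mono[OF that, of n] in \<open>auto simp: carrier_cochain_group PiE_iff subset_iff\<close>)
  then have "group (cochain_group K L G n)"
    using P.subgroup_imp_group by (fastforce simp: cochain_group_def)
  then show ?thesis
    by (rule group.group_comm_groupI) (auto simp: carrier_cochain_group mult_cochain_group m_comm PiE_iff intro!: restrict_ext)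
qed

lemma extend_by_one_closed [simp]:
  "c \<in> carrier (cochain_group K L G n) \<Longrightarrow> extend_by_one G (ordered_simplexes K n) c vs \<in> carrier G"
  by (auto simp: extend_by_one_def carrier_cochain_group)

text \<open>\<open>f\<close> may be any total extension of \<open>c\<close>: later it is the
  extension by one, that extension composed with a simplicial map, or the prism of a
  cocycle.\<close>

lemma coboundary_eq:
  assumes "simplex_family K" "vs \<in> ordered_simplexes K (Suc n)" "\<And>us. f us \<in> carrier G"
    and "\<And>us. us \<in> ordered_simplexes K n \<Longrightarrow> f us = c us"
  shows "coboundary K G n c vs = alternating_prod G vs f"
proof -
  have "{0..Suc n} = {..<length vs}" using assms by (auto simp: ordered_simplexes_def)
  then have "coboundary K G n c vs = (\<Otimes>i\<in>{..<length vs}. c (face i vs) [^] ((-1) ^ i :: int))"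
    using assms by (simp add: coboundary_def)
  also have "\<dots> = (\<Otimes>i\<in>{..<length vs}. f (face i vs) [^] ((-1) ^ i :: int))"
  proof (rule finprod_cong'[OF refl])
    fix i assume "i \<in> {..<length vs}"
    then have "i \<le> Suc n" using assms(2) by (auto simp: ordered_simplexes_def)
    then show "c (face i vs) [^] ((-1) ^ i :: int) = f (face i vs) [^] ((-1) ^ i :: int)"
      using assms(4) ordered_simplexes_face[OF assms(1,2)] by simp
  qed (use assms in auto)
  finally show ?thesis by (simp add: alternating_prod_eq_finprod assms(3))
qed

lemma coboundary_extend:
  assumes "simplex_family K" "c \<in> carrier (cochain_group K L G n)" "vs \<in> ordered_simplexes K (Suc n)"
  shows "coboundary K G n c vs = alternating_prod G vs (extend_by_one G (ordered_simplexes K n) c)"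
  by (rule coboundary_eq) (use assms in \<open>auto simp: extend_by_one_def carrier_cochain_group\<close>)

lemma coboundary_one_on:
  assumes "simplex_family K" "simplex_family L" "L \<subseteq> K" "c \<in> carrier (cochain_group K L G n)"
    "vs \<in> ordered_simplexes L (Suc n)"
  shows "coboundary K G n c vs = \<one>"
proof -
  have "coboundary K G n c vs = (\<Otimes>i\<in>{0..Suc n}. c (face i vs) [^] ((-1) ^ i :: int))"
    using assms(5) ordered_simplexes_mono[OF assms(3), of "Suc n"] by (auto simp: coboundary_def)
  also have "\<dots> = \<one>"
    using assms(4) ordered_simplexes_face[OF assms(2,5)]
    by (intro finprod_one_eqI) (simp add: carrier_cochain_group)
  finally show ?thesis .
qed

lemma coboundary_hom:
  assumes "simplex_family K" "simplex_family L" "L \<subseteq> K"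
  shows "coboundary K G n \<in> hom (cochain_group K L G n) (cochain_group K L G (Suc n))"
proof (rule homI)
  fix c assume c: "c \<in> carrier (cochain_group K L G n)"
  show "coboundary K G n c \<in> carrier (cochain_group K L G (Suc n))"
    unfolding carrier_cochain_group
  proof (intro CollectI conjI ballI PiE_I)
    fix vs assume "vs \<in> ordered_simplexes K (Suc n)"
    then show "coboundary K G n c vs \<in> carrier G"
      using c by (simp add: coboundary_extend[OF assms(1) c])
  qed (use coboundary_one_on[OF assms c] in \<open>auto simp: coboundary_def\<close>)
next
  fix c d assume c: "c \<in> carrier (cochain_group K L G n)" and d: "d \<in> carrier (cochain_group K L G n)"
  interpret C: comm_group "cochain_group K L G n" by (rule comm_group_cochain_group[OF assms(3)])
  have cd: "c \<otimes>\<^bsub>cochain_group K L G n\<^esub> d \<in> carrier (cochain_group K L G n)" using c d by simp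
  show "coboundary K G n (c \<otimes>\<^bsub>cochain_group K L G n\<^esub> d) =
        coboundary K G n c \<otimes>\<^bsub>cochain_group K L G (Suc n)\<^esub> coboundary K G n d"
  proof (rule extensionalityI[where A = "ordered_simplexes K (Suc n)"])
    fix vs assume vs: "vs \<in> ordered_simplexes K (Suc n)"
    have "alternating_prod G vs (extend_by_one G (ordered_simplexes K n) (c \<otimes>\<^bsub>cochain_group K L G n\<^esub> d)) =
       alternating_prod G vs (\<lambda>us. extend_by_one G (ordered_simplexes K n) c us \<otimes> extend_by_one G (ordered_simplexes K n) d us)"
      by (rule arg_cong[where f = "alternating_prod G vs"]) (auto simp: extend_by_one_def mult_cochain_group)
    then show "coboundary K G n (c \<otimes>\<^bsub>cochain_group K L G n\<^esub> d) vs =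
        (coboundary K G n c \<otimes>\<^bsub>cochain_group K L G (Suc n)\<^esub> coboundary K G n d) vs"
      using vs c d cd by (simp add: mult_cochain_group coboundary_extend[OF assms(1)] alternating_prod_mult)
  qed (auto simp: coboundary_def mult_cochain_group)
qed

lemma coboundaries_subgroup:
  assumes "simplex_family K" "simplex_family L" "L \<subseteq> K"
  shows "subgroup (coboundaries K L G n) (cochain_group K L G n)"
proof (cases n)
  case 0
  interpret C: comm_group "cochain_group K L G n" by (rule comm_group_cochain_group[OF assms(3)])
  show ?thesis using 0 C.triv_subgroup by (simp add: coboundaries_def)
next
  case (Suc m)
  interpret C: comm_group "cochain_group K L G m" by (rule comm_group_cochain_group[OF assms(3)])
  interpret D: comm_group "cochain_group K L G (Suc m)" by (rule comm_group_cochain_group[OF assms(3)])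
  interpret group_hom "cochain_group K L G m" "cochain_group K L G (Suc m)" "coboundary K G m"
    by unfold_locales (rule coboundary_hom[OF assms])
  show ?thesis using Suc img_is_subgroup by (simp add: coboundaries_def)
qed

end

section \<open>Pullback along simplicial maps of pairs, and contiguity\<close>

definition simplicial_pair_map :: "'w set set \<Rightarrow> 'w set set \<Rightarrow> 'v set set \<Rightarrow> 'v set set \<Rightarrow> ('w \<Rightarrow> 'v) \<Rightarrow> bool" where
  "simplicial_pair_map K' L' K L p \<longleftrightarrow> (\<forall>s\<in>K'. p ` s \<in> K) \<and> (\<forall>s\<in>L'. p ` s \<in> L)"

definition contiguous :: "'w set set \<Rightarrow> 'v set set \<Rightarrow> ('w \<Rightarrow> 'v) \<Rightarrow> ('w \<Rightarrow> 'v) \<Rightarrow> bool" where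
  "contiguous K' K p q \<longleftrightarrow> (\<forall>s\<in>K'. p ` s \<union> q ` s \<in> K)"

lemma simplicial_pair_mapD:
  assumes "simplicial_pair_map K' L' K L p"
  shows "ws \<in> ordered_simplexes K' n \<Longrightarrow> map p ws \<in> ordered_simplexes K n"
    and "ws \<in> ordered_simplexes L' n \<Longrightarrow> map p ws \<in> ordered_simplexes L n"
  using assms by (auto simp: simplicial_pair_map_def ordered_simplexes_def)

lemma cochain_pullback_comp:
  assumes "simplicial_pair_map K'' L'' K' L' q"
  shows "cochain_pullback K'' n q (cochain_pullback K' n p c) = cochain_pullback K'' n (p \<circ> q) c"
  using simplicial_pair_mapD(1)[OF assms] by (auto simp: cochain_pullback_def intro!: restrict_ext)

context comm_group
begin

lemma cochain_pullback_hom: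
  assumes "L' \<subseteq> K'" "simplicial_pair_map K' L' K L p"
  shows "cochain_pullback K' n p \<in> hom (cochain_group K L G n) (cochain_group K' L' G n)"
  by (rule homI)
     (use simplicial_pair_mapD[OF assms(2), of _ n] ordered_simplexes_mono[OF assms(1), of n] in
      \<open>auto simp: carrier_cochain_group mult_cochain_group cochain_pullback_def PiE_iff intro!: restrict_ext\<close>)

lemma coboundary_pullback:
  assumes "simplex_family K" "simplex_family K'" "simplicial_pair_map K' L' K L p"
    and c: "c \<in> carrier (cochain_group K L G n)"
  shows "coboundary K' G n (cochain_pullback K' n p c) = cochain_pullback K' (Suc n) p (coboundary K G n c)"
proof (rule extensionalityI[where A = "ordered_simplexes K' (Suc n)"])
  fix vs assume vs: "vs \<in> ordered_simplexes K' (Suc n)"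
  \<comment> \<open>\<open>p\<close> sends ordered simplexes of \<open>K'\<close> to ordered
    simplexes of \<open>K\<close>, so this function extends the pullback of
    \<open>c\<close>.\<close>
  let ?f = "\<lambda>us. extend_by_one G (ordered_simplexes K n) c (map p us)"
  have "coboundary K' G n (cochain_pullback K' n p c) vs = alternating_prod G vs ?f"
    by (rule coboundary_eq[OF assms(2) vs])
       (use c simplicial_pair_mapD[OF assms(3), of _ n] in \<open>auto simp: cochain_pullback_def extend_by_one_def carrier_cochain_group PiE_iff\<close>)
  also have "\<dots> = coboundary K G n c (map p vs)"
    using vs simplicial_pair_mapD(1)[OF assms(3)]
    by (simp add: coboundary_extend[OF assms(1) c] alternating_prod_map)
  finally show "coboundary K' G n (cochain_pullback K' n p c) vs = cochain_pullback K' (Suc n) p (coboundary K G n c) vs"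
    using vs by (simp add: cochain_pullback_def)
qed (auto simp: coboundary_def cochain_pullback_def)

lemma coboundaries_pullback:
  assumes "simplex_family K" "simplex_family K'" "L' \<subseteq> K'" "L \<subseteq> K"
    and p: "simplicial_pair_map K' L' K L p" and b: "b \<in> coboundaries K L G n"
  shows "cochain_pullback K' n p b \<in> coboundaries K' L' G n"
proof (cases n)
  case 0
  then show ?thesis
    using b simplicial_pair_mapD(1)[OF p, of _ 0]
    by (auto simp: coboundaries_def one_cochain_group cochain_pullback_def intro!: restrict_ext)
next
  case (Suc m)
  then obtain h where h: "h \<in> carrier (cochain_group K L G m)" "b = coboundary K G m h"
    using b by (auto simp: coboundaries_def)
  then show ?thesis
    using Suc hom_in_carrier[OF cochain_pullback_hom[OF assms(3) p] h(1)]
    by (auto simp: coboundaries_def simp flip: coboundary_pullback[OF assms(1,2) p h(1)])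
qed

lemma cocycles_pullback:
  assumes "simplex_family K" "simplex_family K'" "L' \<subseteq> K'" "L \<subseteq> K"
    and p: "simplicial_pair_map K' L' K L p" and c: "c \<in> cocycles K L G n"
  shows "cochain_pullback K' n p c \<in> cocycles K' L' G n"
proof -
  have cc: "c \<in> carrier (cochain_group K L G n)" and d: "coboundary K G n c = \<one>\<^bsub>cochain_group K L G (Suc n)\<^esub>"
    using c by (auto simp: cocycles_def kernel_def)
  have "coboundary K' G n (cochain_pullback K' n p c) = \<one>\<^bsub>cochain_group K' L' G (Suc n)\<^esub>"
    unfolding coboundary_pullback[OF assms(1,2) p cc] d
    using simplicial_pair_mapD(1)[OF p, of _ "Suc n"]
    by (auto simp: one_cochain_group cochain_pullback_def intro!: restrict_ext)
  then show ?thesis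
    using hom_in_carrier[OF cochain_pullback_hom[OF assms(3) p] cc] by (auto simp: cocycles_def kernel_def)
qed

lemma alternating_prod_cocycle:
  assumes "simplex_family K" "c \<in> cocycles K L G n" "vs \<in> ordered_simplexes K (Suc n)"
  shows "alternating_prod G vs (extend_by_one G (ordered_simplexes K n) c) = \<one>"
  using coboundary_extend[of K c L n vs] assms by (auto simp: cocycles_def kernel_def one_cochain_group)

text \<open>The recursion evaluates \<open>f\<close> only on lists that follow \<open>p\<close> up
  to some vertex of \<open>ws\<close> and \<open>q\<close> from that vertex on; these have one entry
  more than \<open>ws\<close>.\<close>

lemma prism_one_on:
  assumes "\<And>us. set us \<subseteq> p ` set ws \<union> q ` set ws \<Longrightarrow> length us = Suc (length ws) \<Longrightarrow> f us = \<one>"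
  shows "prism G p q ws f = \<one>"
  using assms
proof (induction ws arbitrary: f)
  case (Cons w ws)
  have "f (p w # q w # map q ws) = \<one>" by (rule Cons.prems) auto
  moreover have "prism G p q ws (\<lambda>us. f (p w # us)) = \<one>"
    by (rule Cons.IH, rule Cons.prems) auto
  ultimately show ?case by simp
qed simp

text \<open>By contiguity all lists in the prism span simplexes of \<open>K\<close>. This serves
  twice: for \<open>K\<close> with the cocycle identity, and for the subcomplex with a cochain that
  vanishes there.\<close>

lemma prism_simplex_family:
  assumes "simplex_family K" "contiguous K' K p q" "set ws \<in> K'"
    and "\<And>us. us \<in> ordered_simplexes K (length ws) \<Longrightarrow> f us = \<one>"
  shows "prism G p q ws f = \<one>"
proof (rule prism_one_on)
  fix us assume us: "set us \<subseteq> p ` set ws \<union> q ` set ws" "length us = Suc (length ws)"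
  then have "set us \<noteq> {}" by auto
  then have "set us \<in> K" using us assms(1-3) by (auto simp: contiguous_def simplex_family_def)
  then show "f us = \<one>" using us assms(4) by (simp add: ordered_simplexes_def)
qed

text \<open>The pullbacks of a cocycle along \<open>p\<close> and \<open>q\<close> differ by the
  coboundary of its prism, so both or neither are coboundaries. One implication suffices, as
  \<open>p\<close> and \<open>q\<close> can be exchanged.\<close>

lemma contiguous_pullback:
  assumes fam: "simplex_family K" "simplex_family L" "simplex_family K'" "simplex_family L'" "L' \<subseteq> K'" "L \<subseteq> K"
    and p: "simplicial_pair_map K' L' K L p" and q: "simplicial_pair_map K' L' K L q"
    and cont: "contiguous K' K p q" "contiguous L' L p q" and c: "c \<in> cocycles K L G n"
    and pc: "cochain_pullback K' n p c \<in> coboundaries K' L' G n"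
  shows "cochain_pullback K' n q c \<in> coboundaries K' L' G n"
proof -
  let ?f = "extend_by_one G (ordered_simplexes K n) c"
  have cc: "c \<in> carrier (cochain_group K L G n)" using c by (auto simp: cocycles_def kernel_def)
  have fG [simp]: "?f us \<in> carrier G" for us using cc by simp
  have pcG: "cochain_pullback K' n p c \<in> carrier (cochain_group K' L' G n)"
    "cochain_pullback K' n q c \<in> carrier (cochain_group K' L' G n)"
    using hom_in_carrier[OF cochain_pullback_hom[OF fam(5)] cc] p q by blast+
  \<comment> \<open>The homotopy formula with its first factor trivial: that factor evaluates the
    coboundary of \<open>c\<close> on lists which by contiguity span simplexes of
    \<open>K\<close>.\<close>
  have key: "alternating_prod G ws (\<lambda>us. prism G p q us ?f) \<otimes> c (map p ws) = c (map q ws)"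
    if ws: "ws \<in> ordered_simplexes K' n" for ws
  proof -
    have "prism G p q ws (\<lambda>us. alternating_prod G us ?f) = \<one>"
    proof (rule prism_simplex_family[OF fam(1) cont(1)])
      show "set ws \<in> K'" using ws by (simp add: ordered_simplexes_def)
      show "alternating_prod G us ?f = \<one>" if "us \<in> ordered_simplexes K (length ws)" for us
        using that ws alternating_prod_cocycle[OF fam(1) c, of us] by (simp add: ordered_simplexes_def)
    qed
    moreover have "?f (map p ws) = c (map p ws)" "?f (map q ws) = c (map q ws)"
      using simplicial_pair_mapD(1)[OF p ws] simplicial_pair_mapD(1)[OF q ws] by (auto simp: extend_by_one_def)
    ultimately show ?thesis
      using prism_homotopy[of ?f p q ws] fG[of "map p ws"] fG[of "map q ws"] by (simp add: m_assoc)
  qed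
  show ?thesis
  proof (cases n)
    case 0
    \<comment> \<open>The only face of a single vertex is the empty list, where the prism is
      trivial. Equality of the pullbacks is what is required, since in degree 0 only the trivial
      cochain is a coboundary.\<close>
    have "c (map q ws) = c (map p ws)" if ws: "ws \<in> ordered_simplexes K' 0" for ws
    proof -
      obtain w where "ws = [w]" using ws by (auto simp: ordered_simplexes_def length_Suc_conv)
      moreover have "c (map p ws) \<in> carrier G"
        using cc simplicial_pair_mapD(1)[OF p ws] 0 by (auto simp: carrier_cochain_group)
      ultimately show ?thesis using key[of ws] ws 0 by simp
    qed
    then have "cochain_pullback K' n q c = cochain_pullback K' n p c"
      using 0 by (auto simp: cochain_pullback_def intro!: restrict_ext)
    then show ?thesis using pc by simp
  next
    case (Suc m)
    interpret B: subgroup "coboundaries K' L' G n" "cochain_group K' L' G n"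
      by (rule coboundaries_subgroup[OF fam(3-5)])
    define h where "h = (\<lambda>us\<in>ordered_simplexes K' m. prism G p q us ?f)"
    have h: "h \<in> carrier (cochain_group K' L' G m)"
    proof -
      \<comment> \<open>\<open>h\<close> is a relative cochain: contiguity of the subcomplexes
        confines the prism over a simplex of \<open>L'\<close> to \<open>L\<close>, where
        \<open>c\<close> is trivial.\<close>
      have "prism G p q us ?f = \<one>" if us: "us \<in> ordered_simplexes L' m" for us
      proof (rule prism_simplex_family[OF fam(2) cont(2)])
        show "set us \<in> L'" using us by (simp add: ordered_simplexes_def)
        fix vs assume vs: "vs \<in> ordered_simplexes L (length us)"
        then have "vs \<in> ordered_simplexes L n" using us Suc by (simp add: ordered_simplexes_def)
        then show "?f vs = \<one>" using cc by (auto simp: carrier_cochain_group extend_by_one_def)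
      qed
      then show ?thesis
        using ordered_simplexes_mono[OF fam(5), of m] by (auto simp: h_def carrier_cochain_group)
    qed
    have "cochain_pullback K' n q c = coboundary K' G m h \<otimes>\<^bsub>cochain_group K' L' G n\<^esub> cochain_pullback K' n p c"
    proof (rule extensionalityI[where A = "ordered_simplexes K' n"])
      fix ws assume ws: "ws \<in> ordered_simplexes K' n"
      have "coboundary K' G m h ws = alternating_prod G ws (\<lambda>us. prism G p q us ?f)"
        by (rule coboundary_eq[OF fam(3)]) (use ws Suc prism_closed[OF fG] in \<open>auto simp: h_def\<close>)
      then show "cochain_pullback K' n q c ws =
          (coboundary K' G m h \<otimes>\<^bsub>cochain_group K' L' G n\<^esub> cochain_pullback K' n p c) ws"
        using ws key[OF ws] by (simp add: mult_cochain_group cochain_pullback_def)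
    qed (auto simp: cochain_pullback_def mult_cochain_group)
    moreover have "coboundary K' G m h \<in> coboundaries K' L' G n"
      using h Suc by (simp add: coboundaries_def)
    ultimately show ?thesis using pc by simp
  qed
qed

end

section \<open>Nontriviality of the limit cohomology\<close>

lemma Car_antimono: "t \<subseteq> s \<Longrightarrow> Car \<alpha> s \<subseteq> Car \<alpha> t"
  by (auto simp: Car_def)

lemma simplex_family_nerve: "simplex_family (nerve \<alpha>)"
  unfolding simplex_family_def
proof (intro ballI allI impI)
  fix s t assume "s \<in> nerve \<alpha>" "t \<subseteq> s" "t \<noteq> {}"
  then show "t \<in> nerve \<alpha>"
    using Car_antimono[of t s \<alpha>] finite_subset[of t s] by (auto simp: nerve_def)
qed

lemma simplex_family_subnerve: "simplex_family (subnerve A \<alpha>)"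
  unfolding simplex_family_def
proof (intro ballI allI impI)
  fix s t assume "s \<in> subnerve A \<alpha>" "t \<subseteq> s" "t \<noteq> {}"
  then show "t \<in> subnerve A \<alpha>"
    using Car_antimono[of t s \<alpha>] finite_subset[of t s] by (auto simp: nerve_def subnerve_def)
qed

lemma subnerve_subset: "subnerve A \<alpha> \<subseteq> nerve \<alpha>"
  by (auto simp: subnerve_def)

lemmas nerve_simps = simplex_family_nerve simplex_family_subnerve subnerve_subset

lemma Car_refinement:
  assumes "refinement_projection \<alpha> \<beta> p" "s \<subseteq> index \<beta>"
  shows "Car \<beta> s \<subseteq> Car \<alpha> (p ` s)"
  using assms by (fastforce simp: refinement_projection_def Car_def)

lemma simplicial_pair_map_refinement:
  assumes "refinement_projection \<alpha> \<beta> p"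
  shows "simplicial_pair_map (nerve \<beta>) (subnerve A \<beta>) (nerve \<alpha>) (subnerve A \<alpha>) p"
proof -
  have p: "p ` index \<beta> \<subseteq> index \<alpha>" "p ` subindex \<beta> \<subseteq> subindex \<alpha>"
    using assms by (auto simp: refinement_projection_def)
  have N: "p ` s \<in> nerve \<alpha>" if "s \<in> nerve \<beta>" for s
  proof -
    have "s \<subseteq> index \<beta>" using that by (simp add: nerve_def)
    then have "p ` s \<subseteq> index \<alpha>" using p(1) by blast
    then show ?thesis using that Car_refinement[OF assms, of s] by (auto simp: nerve_def)
  qed
  moreover have "p ` s \<in> subnerve A \<alpha>" if "s \<in> subnerve A \<beta>" for s
  proof -
    have "s \<in> nerve \<beta>" "s \<subseteq> subindex \<beta>" "Car \<beta> s \<inter> A \<noteq> {}" "s \<subseteq> index \<beta>"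
      using that by (auto simp: subnerve_def nerve_def)
    moreover from this have "p ` s \<subseteq> subindex \<alpha>" using p(2) by blast
    ultimately show ?thesis using N[of s] Car_refinement[OF assms, of s] by (auto simp: subnerve_def)
  qed
  ultimately show ?thesis by (simp add: simplicial_pair_map_def)
qed

text \<open>Every point of \<open>Car \<beta> s\<close> lies in the parts of \<open>\<alpha>\<close>
  indexed by the images of \<open>s\<close> under \<open>p\<close> and under \<open>q\<close>, so
  the two images together span one simplex. For a point of \<open>A\<close> the same holds in the
  subnerves.\<close>

lemma contiguous_refinement:
  assumes p: "refinement_projection \<alpha> \<beta> p" and q: "refinement_projection \<alpha> \<beta> q"
  shows "contiguous (nerve \<beta>) (nerve \<alpha>) p q" "contiguous (subnerve A \<beta>) (subnerve A \<alpha>) p q"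
proof -
  have *: "Car \<beta> s \<subseteq> Car \<alpha> (p ` s \<union> q ` s)" if "s \<subseteq> index \<beta>" for s
    using Car_refinement[OF p that] Car_refinement[OF q that] by (auto simp: Car_def)
  have idx: "p ` index \<beta> \<subseteq> index \<alpha>" "q ` index \<beta> \<subseteq> index \<alpha>" "p ` subindex \<beta> \<subseteq> subindex \<alpha>" "q ` subindex \<beta> \<subseteq> subindex \<alpha>"
    using p q by (auto simp: refinement_projection_def)
  have N: "p ` s \<union> q ` s \<in> nerve \<alpha>" if "s \<in> nerve \<beta>" for s
  proof -
    have "Car \<alpha> (p ` s \<union> q ` s) \<noteq> {}" using that *[of s] by (auto simp: nerve_def)
    moreover have "s \<subseteq> index \<beta>" using that by (simp add: nerve_def)
    then have "p ` s \<union> q ` s \<subseteq> index \<alpha>" using idx(1,2) by blast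
    ultimately show ?thesis using that by (auto simp: nerve_def)
  qed
  then show "contiguous (nerve \<beta>) (nerve \<alpha>) p q" by (simp add: contiguous_def)
  have "p ` s \<union> q ` s \<in> subnerve A \<alpha>" if "s \<in> subnerve A \<beta>" for s
  proof -
    have "Car \<alpha> (p ` s \<union> q ` s) \<inter> A \<noteq> {}" using that *[of s] by (auto simp: subnerve_def nerve_def)
    moreover have "s \<subseteq> subindex \<beta>" "s \<in> nerve \<beta>" using that by (simp_all add: subnerve_def)
    then have "p ` s \<union> q ` s \<subseteq> subindex \<alpha>" "p ` s \<union> q ` s \<in> nerve \<alpha>" using idx(3,4) N by blast+
    ultimately show ?thesis by (simp add: subnerve_def)
  qed
  then show "contiguous (subnerve A \<beta>) (subnerve A \<alpha>) p q" by (simp add: contiguous_def)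
qed

lemma refinement_projection_id: "refinement_projection \<alpha> \<alpha> id"
  by (simp add: refinement_projection_def)

lemma refinement_projection_comp:
  "refinement_projection \<alpha> \<beta> p \<Longrightarrow> refinement_projection \<beta> \<gamma> q \<Longrightarrow> refinement_projection \<alpha> \<gamma> (p \<circ> q)"
  by (fastforce simp: refinement_projection_def)

lemma refined_by_trans: "refined_by \<alpha> \<beta> \<Longrightarrow> refined_by \<beta> \<gamma> \<Longrightarrow> refined_by \<alpha> \<gamma>"
  unfolding refined_by_def using refinement_projection_comp by blast

text \<open>Such a cocycle represents an element of the direct limit other than the unit.
  Quantifying over all projections avoids the choice made in \<open>refinement_map\<close>.\<close>

definition persistent_cocycle ::
  "'a family set \<Rightarrow> 'a set \<Rightarrow> ('g, 'm) monoid_scheme \<Rightarrow> nat \<Rightarrow> 'a family \<Rightarrow> (nat list \<Rightarrow> 'g) \<Rightarrow> bool" where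
  "persistent_cocycle \<C> A G n \<alpha> c \<longleftrightarrow>
     \<alpha> \<in> \<C> \<and> c \<in> cocycles (nerve \<alpha>) (subnerve A \<alpha>) G n \<and>
     (\<forall>\<beta>\<in>\<C>. \<forall>p. refinement_projection \<alpha> \<beta> p \<longrightarrow>
        cochain_pullback (nerve \<beta>) n p c \<notin> coboundaries (nerve \<beta>) (subnerve A \<beta>) G n)"

lemma carrier_simplicial_cohomology:
  "carrier (simplicial_cohomology K L G n) =
   (\<lambda>c. coboundaries K L G n #>\<^bsub>cochain_group K L G n\<^esub> c) ` cocycles K L G n"
  by (simp add: simplicial_cohomology_def carrier_FactGroup r_coset_def)

lemma one_simplicial_cohomology: "\<one>\<^bsub>simplicial_cohomology K L G n\<^esub> = coboundaries K L G n"
  by (simp add: simplicial_cohomology_def)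

context comm_group
begin

lemma one_cocycle:
  assumes "simplex_family K" "simplex_family L" "L \<subseteq> K"
  shows "\<one>\<^bsub>cochain_group K L G n\<^esub> \<in> cocycles K L G n"
  using hom_one[OF coboundary_hom[OF assms]] comm_group_cochain_group[OF assms(3)]
  by (auto simp: cocycles_def kernel_def comm_group_def group.is_monoid)

text \<open>The pullback of a coset may be only part of a coset; multiplying by the coboundaries of
  the target completes it, because coboundaries pull back to coboundaries.\<close>

lemma cohomology_map_coset:
  assumes fam: "simplex_family K" "simplex_family L" "L \<subseteq> K" "simplex_family K'" "simplex_family L'" "L' \<subseteq> K'"
    and p: "simplicial_pair_map K' L' K L p" and c: "c \<in> carrier (cochain_group K L G n)"
  shows "cohomology_map K' L' G n p (coboundaries K L G n #>\<^bsub>cochain_group K L G n\<^esub> c)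
       = coboundaries K' L' G n #>\<^bsub>cochain_group K' L' G n\<^esub> cochain_pullback K' n p c"
proof -
  let ?C = "cochain_group K L G n" and ?D = "cochain_group K' L' G n"
  interpret C: comm_group ?C by (rule comm_group_cochain_group[OF fam(3)])
  interpret D: comm_group ?D by (rule comm_group_cochain_group[OF fam(6)])
  interpret B: subgroup "coboundaries K L G n" ?C by (rule coboundaries_subgroup[OF fam(1-3)])
  interpret B': subgroup "coboundaries K' L' G n" ?D by (rule coboundaries_subgroup[OF fam(4-6)])
  note hom = cochain_pullback_hom[OF fam(6) p, of n]
  have pc: "cochain_pullback K' n p c \<in> carrier ?D" using hom_in_carrier[OF hom c] .
  have pb: "cochain_pullback K' n p b \<in> coboundaries K' L' G n" if "b \<in> coboundaries K L G n" for b
    using coboundaries_pullback[OF fam(1,4,6,3) p that] .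
  have eq: "b' \<otimes>\<^bsub>?D\<^esub> cochain_pullback K' n p (b \<otimes>\<^bsub>?C\<^esub> c)
      = (b' \<otimes>\<^bsub>?D\<^esub> cochain_pullback K' n p b) \<otimes>\<^bsub>?D\<^esub> cochain_pullback K' n p c"
    if "b \<in> coboundaries K L G n" "b' \<in> coboundaries K' L' G n" for b b'
    using that pb[OF that(1)] pc hom_mult[OF hom _ c] by (simp add: D.m_assoc)
  show ?thesis
  proof
    show "cohomology_map K' L' G n p (coboundaries K L G n #>\<^bsub>?C\<^esub> c) \<subseteq> coboundaries K' L' G n #>\<^bsub>?D\<^esub> cochain_pullback K' n p c"
    proof
      fix z assume "z \<in> cohomology_map K' L' G n p (coboundaries K L G n #>\<^bsub>?C\<^esub> c)"
      then obtain b b' where b: "b \<in> coboundaries K L G n" "b' \<in> coboundaries K' L' G n"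
        and z: "z = b' \<otimes>\<^bsub>?D\<^esub> cochain_pullback K' n p (b \<otimes>\<^bsub>?C\<^esub> c)"
        unfolding cohomology_map_def set_mult_def r_coset_def by blast
      then show "z \<in> coboundaries K' L' G n #>\<^bsub>?D\<^esub> cochain_pullback K' n p c"
        unfolding z eq[OF b] using B'.m_closed[OF b(2) pb[OF b(1)]] unfolding r_coset_def by blast
    qed
    show "coboundaries K' L' G n #>\<^bsub>?D\<^esub> cochain_pullback K' n p c \<subseteq> cohomology_map K' L' G n p (coboundaries K L G n #>\<^bsub>?C\<^esub> c)"
    proof
      fix z assume "z \<in> coboundaries K' L' G n #>\<^bsub>?D\<^esub> cochain_pullback K' n p c"
      then obtain b' where b': "b' \<in> coboundaries K' L' G n" and z: "z = b' \<otimes>\<^bsub>?D\<^esub> cochain_pullback K' n p c"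
        unfolding r_coset_def by blast
      have "\<one>\<^bsub>?C\<^esub> \<otimes>\<^bsub>?C\<^esub> c \<in> coboundaries K L G n #>\<^bsub>?C\<^esub> c"
        using B.one_closed unfolding r_coset_def by blast
      then have "c \<in> coboundaries K L G n #>\<^bsub>?C\<^esub> c" using c by simp
      then show "z \<in> cohomology_map K' L' G n p (coboundaries K L G n #>\<^bsub>?C\<^esub> c)"
        unfolding z cohomology_map_def set_mult_def using b' by blast
    qed
  qed
qed

text \<open>\<open>refinement_map\<close> uses a projection \<open>q\<close> chosen by
  \<open>SOME\<close>. A coset equals the subgroup iff its representative lies in it, and contiguity
  moves this condition from \<open>q\<close> to any given \<open>p\<close>.\<close>

lemma refinement_map_coset_eq_one_iff:
  assumes "refinement_projection \<alpha> \<beta> p" and c: "c \<in> cocycles (nerve \<alpha>) (subnerve A \<alpha>) G n"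
  shows "refinement_map A G n \<alpha> \<beta>
           (coboundaries (nerve \<alpha>) (subnerve A \<alpha>) G n #>\<^bsub>cochain_group (nerve \<alpha>) (subnerve A \<alpha>) G n\<^esub> c)
           = coboundaries (nerve \<beta>) (subnerve A \<beta>) G n \<longleftrightarrow>
         cochain_pullback (nerve \<beta>) n p c \<in> coboundaries (nerve \<beta>) (subnerve A \<beta>) G n"
    (is "?l = ?B \<longleftrightarrow> _")
proof -
  let ?D = "cochain_group (nerve \<beta>) (subnerve A \<beta>) G n"
  define q where "q = (SOME p. refinement_projection \<alpha> \<beta> p)"
  have q: "refinement_projection \<alpha> \<beta> q"
    unfolding q_def using assms(1) by (rule someI[of "refinement_projection \<alpha> \<beta>"])
  have cc: "c \<in> carrier (cochain_group (nerve \<alpha>) (subnerve A \<alpha>) G n)"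
    using c by (simp add: cocycles_def kernel_def)
  interpret D: comm_group ?D by (rule comm_group_cochain_group[OF subnerve_subset])
  interpret B: subgroup ?B ?D by (intro coboundaries_subgroup nerve_simps)
  have qc: "cochain_pullback (nerve \<beta>) n q c \<in> carrier ?D"
    using hom_in_carrier[OF cochain_pullback_hom[OF subnerve_subset simplicial_pair_map_refinement[OF q]] cc] .
  have move: "cochain_pullback (nerve \<beta>) n q' c \<in> ?B"
    if "refinement_projection \<alpha> \<beta> p'" "refinement_projection \<alpha> \<beta> q'" "cochain_pullback (nerve \<beta>) n p' c \<in> ?B" for p' q'
    by (rule contiguous_pullback[OF simplex_family_nerve simplex_family_subnerve simplex_family_nerve simplex_family_subnerve
          subnerve_subset subnerve_subset simplicial_pair_map_refinement[OF that(1)] simplicial_pair_map_refinement[OF that(2)]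
          contiguous_refinement[OF that(1,2)] c that(3)])
  have "?l = ?B #>\<^bsub>?D\<^esub> cochain_pullback (nerve \<beta>) n q c"
    unfolding refinement_map_def q_def[symmetric]
    by (intro cohomology_map_coset nerve_simps simplicial_pair_map_refinement q cc)
  then have "?l = ?B \<longleftrightarrow> cochain_pullback (nerve \<beta>) n q c \<in> ?B"
    using D.coset_join1[OF _ qc B.subgroup_axioms] D.coset_join2[OF qc B.subgroup_axioms] by blast
  also have "\<dots> \<longleftrightarrow> cochain_pullback (nerve \<beta>) n p c \<in> ?B"
    using move[OF assms(1) q] move[OF q assms(1)] by blast
  finally show ?thesis .
qed

lemma pullback_refinement_coboundary:
  assumes p: "refinement_projection \<alpha> \<beta> p" and q: "refinement_projection \<beta> \<gamma> q"
    and "cochain_pullback (nerve \<beta>) n p c \<in> coboundaries (nerve \<beta>) (subnerve A \<beta>) G n"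
  shows "cochain_pullback (nerve \<gamma>) n (p \<circ> q) c \<in> coboundaries (nerve \<gamma>) (subnerve A \<gamma>) G n"
  by (subst cochain_pullback_comp[OF simplicial_pair_map_refinement[OF q, of A], symmetric], rule coboundaries_pullback[OF simplex_family_nerve simplex_family_nerve subnerve_subset subnerve_subset
      simplicial_pair_map_refinement[OF q] assms(3)])

text \<open>A persistent cocycle is never identified with a unit. Conversely, if every cocycle dies
  on some refinement, directedness identifies all elements with each other and a single class
  remains.\<close>

lemma limit_cohomology_nontrivial_iff:
  assumes "\<C> \<noteq> {}"
    and directed: "\<And>\<alpha> \<beta>. \<alpha> \<in> \<C> \<Longrightarrow> \<beta> \<in> \<C> \<Longrightarrow> \<exists>\<gamma>\<in>\<C>. refined_by \<alpha> \<gamma> \<and> refined_by \<beta> \<gamma>"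
  shows "carrier (limit_cohomology \<C> A G n) \<noteq> {\<one>\<^bsub>limit_cohomology \<C> A G n\<^esub>} \<longleftrightarrow>
         (\<exists>\<alpha> c. persistent_cocycle \<C> A G n \<alpha> c)"
proof -
  let ?H = "\<lambda>\<alpha>. simplicial_cohomology (nerve \<alpha>) (subnerve A \<alpha>) G n"
  let ?B = "\<lambda>\<alpha>. coboundaries (nerve \<alpha>) (subnerve A \<alpha>) G n"
  let ?C = "\<lambda>\<alpha>. cochain_group (nerve \<alpha>) (subnerve A \<alpha>) G n"
  let ?Z = "\<lambda>\<alpha>. cocycles (nerve \<alpha>) (subnerve A \<alpha>) G n"
  define R where "R = direct_limit_rel \<C> refined_by ?H (refinement_map A G n)"
  define S where "S = (SIGMA \<alpha>:\<C>. carrier (?H \<alpha>))"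
  have carr: "carrier (limit_cohomology \<C> A G n) = S // R"
    and one: "\<one>\<^bsub>limit_cohomology \<C> A G n\<^esub> = (\<Union>\<alpha>\<in>\<C>. R `` {(\<alpha>, ?B \<alpha>)})"
    by (simp_all add: limit_cohomology_def direct_limit_def R_def S_def Let_def one_simplicial_cohomology)
  \<comment> \<open>The unit of each cohomology group is the coset of the trivial cocycle, so
    \<open>refinement_map_coset_eq_one_iff\<close> applies to units as well.\<close>
  have unit: "?B \<alpha> = ?B \<alpha> #>\<^bsub>?C \<alpha>\<^esub> \<one>\<^bsub>?C \<alpha>\<^esub>" "\<one>\<^bsub>?C \<alpha>\<^esub> \<in> ?Z \<alpha>" for \<alpha>
  proof -
    interpret C: comm_group "?C \<alpha>" by (rule comm_group_cochain_group[OF subnerve_subset])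
    show "?B \<alpha> = ?B \<alpha> #>\<^bsub>?C \<alpha>\<^esub> \<one>\<^bsub>?C \<alpha>\<^esub>"
      by (rule C.coset_mult_one[symmetric], rule subgroup.subset[OF coboundaries_subgroup]) (rule nerve_simps)+
    show "\<one>\<^bsub>?C \<alpha>\<^esub> \<in> ?Z \<alpha>" by (intro one_cocycle nerve_simps)
  qed
  then have BH: "?B \<alpha> \<in> carrier (?H \<alpha>)" for \<alpha>
    unfolding carrier_simplicial_cohomology by (rule image_eqI)
  have map_unit: "refinement_map A G n \<alpha> \<beta> (?B \<alpha>) = ?B \<beta>" if ref: "refined_by \<alpha> \<beta>" for \<alpha> \<beta>
  proof -
    obtain p where p: "refinement_projection \<alpha> \<beta> p" using ref by (auto simp: refined_by_def)
    have "cochain_pullback (nerve \<beta>) n p \<one>\<^bsub>?C \<alpha>\<^esub> \<in> ?B \<beta>"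
      by (rule coboundaries_pullback[OF simplex_family_nerve simplex_family_nerve subnerve_subset subnerve_subset
          simplicial_pair_map_refinement[OF p]])
        (rule subgroup.one_closed[OF coboundaries_subgroup[OF nerve_simps]])
    then show ?thesis
      using refinement_map_coset_eq_one_iff[OF p unit(2)] unfolding unit(1)[symmetric] by blast
  qed
  show ?thesis
  proof
    assume "\<exists>\<alpha> c. persistent_cocycle \<C> A G n \<alpha> c"
    then obtain \<alpha> c where \<alpha>: "\<alpha> \<in> \<C>" and c: "c \<in> ?Z \<alpha>"
      and ess: "\<And>\<beta> p. \<beta> \<in> \<C> \<Longrightarrow> refinement_projection \<alpha> \<beta> p \<Longrightarrow> cochain_pullback (nerve \<beta>) n p c \<notin> ?B \<beta>"
      by (auto simp: persistent_cocycle_def)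
    let ?z = "?B \<alpha> #>\<^bsub>?C \<alpha>\<^esub> c"
    have z: "?z \<in> carrier (?H \<alpha>)" unfolding carrier_simplicial_cohomology using c by (rule imageI)
    show "carrier (limit_cohomology \<C> A G n) \<noteq> {\<one>\<^bsub>limit_cohomology \<C> A G n\<^esub>}"
    proof
      assume triv: "carrier (limit_cohomology \<C> A G n) = {\<one>\<^bsub>limit_cohomology \<C> A G n\<^esub>}"
      have "R `` {(\<alpha>, ?z)} \<in> S // R"
        by (rule quotientI) (use \<alpha> z in \<open>simp add: S_def\<close>)
      then have "R `` {(\<alpha>, ?z)} = (\<Union>\<alpha>\<in>\<C>. R `` {(\<alpha>, ?B \<alpha>)})"
        unfolding triv[unfolded carr one] by (rule singletonD)
      \<comment> \<open>If the limit is trivial, the class of \<open>?z\<close> is its unit and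
        contains \<open>?B \<alpha>\<close> by reflexivity, so the two become equal on some
        \<open>\<beta>\<close>.\<close>
      moreover have "((\<alpha>, ?B \<alpha>), (\<alpha>, ?B \<alpha>)) \<in> R"
        using \<alpha> BH refinement_projection_id[of \<alpha>] by (auto simp: R_def direct_limit_rel_def refined_by_def)
      ultimately have "(\<alpha>, ?B \<alpha>) \<in> R `` {(\<alpha>, ?z)}" using \<alpha> by blast
      then have "((\<alpha>, ?z), (\<alpha>, ?B \<alpha>)) \<in> R" by simp
      then obtain \<beta> where \<beta>: "\<beta> \<in> \<C>" "refined_by \<alpha> \<beta>" "refinement_map A G n \<alpha> \<beta> ?z = refinement_map A G n \<alpha> \<beta> (?B \<alpha>)"
        by (auto simp: R_def direct_limit_rel_def)
      then obtain p where p: "refinement_projection \<alpha> \<beta> p" by (auto simp: refined_by_def)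
      have "refinement_map A G n \<alpha> \<beta> ?z = ?B \<beta>" using \<beta>(3) map_unit[OF \<beta>(2)] by (rule trans)
      then show False
        using refinement_map_coset_eq_one_iff[OF p c] ess[OF \<beta>(1) p] by blast
    qed
  next
    assume nontriv: "carrier (limit_cohomology \<C> A G n) \<noteq> {\<one>\<^bsub>limit_cohomology \<C> A G n\<^esub>}"
    show "\<exists>\<alpha> c. persistent_cocycle \<C> A G n \<alpha> c"
    proof (rule ccontr)
      assume none: "\<nexists>\<alpha> c. persistent_cocycle \<C> A G n \<alpha> c"
      \<comment> \<open>Vanishing is recorded for all refinements of \<open>\<beta>\<close>, since
        two elements are going to be compared on a common refinement.\<close>
      have dies: "\<exists>\<beta>\<in>\<C>. refined_by \<alpha> \<beta> \<and> (\<forall>\<gamma>. refined_by \<beta> \<gamma> \<longrightarrow> refinement_map A G n \<alpha> \<gamma> z = ?B \<gamma>)"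
        if "\<alpha> \<in> \<C>" and z: "z \<in> carrier (?H \<alpha>)" for \<alpha> z
      proof -
        obtain c where c: "c \<in> ?Z \<alpha>" and zc: "z = ?B \<alpha> #>\<^bsub>?C \<alpha>\<^esub> c"
          using z by (auto simp: carrier_simplicial_cohomology)
        obtain \<beta> p where \<beta>: "\<beta> \<in> \<C>" and p: "refinement_projection \<alpha> \<beta> p" "cochain_pullback (nerve \<beta>) n p c \<in> ?B \<beta>"
        proof -
          have "\<not> persistent_cocycle \<C> A G n \<alpha> c" using none by blast
          then show ?thesis using \<open>\<alpha> \<in> \<C>\<close> c that unfolding persistent_cocycle_def by blast
        qed
        have "refinement_map A G n \<alpha> \<gamma> z = ?B \<gamma>" if ref: "refined_by \<beta> \<gamma>" for \<gamma>
        proof -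
          obtain q where q: "refinement_projection \<beta> \<gamma> q" using ref by (auto simp: refined_by_def)
          show ?thesis
            unfolding zc refinement_map_coset_eq_one_iff[OF refinement_projection_comp[OF p(1) q] c]
            by (rule pullback_refinement_coboundary[OF p(1) q p(2)])
        qed
        then show ?thesis using \<beta> p by (auto simp: refined_by_def)
      qed
      have "R = S \<times> S"
      proof
        show "R \<subseteq> S \<times> S" by (auto simp: R_def S_def direct_limit_rel_def)
        show "S \<times> S \<subseteq> R"
        proof clarify
          fix \<alpha> x \<beta> y assume "(\<alpha>, x) \<in> S" "(\<beta>, y) \<in> S"
          then have x: "\<alpha> \<in> \<C>" "x \<in> carrier (?H \<alpha>)" and y: "\<beta> \<in> \<C>" "y \<in> carrier (?H \<beta>)" by (auto simp: S_def)
          from dies[OF x] obtain \<alpha>' where \<alpha>': "\<alpha>' \<in> \<C>" "refined_by \<alpha> \<alpha>'"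
            "\<And>\<gamma>. refined_by \<alpha>' \<gamma> \<Longrightarrow> refinement_map A G n \<alpha> \<gamma> x = ?B \<gamma>" by blast
          from dies[OF y] obtain \<beta>' where \<beta>': "\<beta>' \<in> \<C>" "refined_by \<beta> \<beta>'"
            "\<And>\<gamma>. refined_by \<beta>' \<gamma> \<Longrightarrow> refinement_map A G n \<beta> \<gamma> y = ?B \<gamma>" by blast
          obtain \<gamma> where \<gamma>: "\<gamma> \<in> \<C>" "refined_by \<alpha>' \<gamma>" "refined_by \<beta>' \<gamma>" using directed \<alpha>' \<beta>' by blast
          then have "refinement_map A G n \<alpha> \<gamma> x = refinement_map A G n \<beta> \<gamma> y" using \<alpha>' \<beta>' by simp
          moreover have "refined_by \<alpha> \<gamma>" "refined_by \<beta> \<gamma>"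
            using \<gamma> refined_by_trans[OF \<alpha>'(2)] refined_by_trans[OF \<beta>'(2)] by blast+
          ultimately show "((\<alpha>, x), (\<beta>, y)) \<in> R"
            using x y \<gamma>(1) unfolding R_def direct_limit_rel_def by blast
        qed
      qed
      moreover have B_S: "(\<alpha>, ?B \<alpha>) \<in> S" if "\<alpha> \<in> \<C>" for \<alpha> using that BH by (simp add: S_def)
      ultimately have "R `` {z} = S" if "z \<in> S" for z using that by blast
      \<comment> \<open>As \<open>\<C>\<close> is nonempty, so is \<open>S\<close>, and the quotient
        has exactly one class.\<close>
      then have "S // R = {S}" "(\<Union>\<alpha>\<in>\<C>. R `` {(\<alpha>, ?B \<alpha>)}) = S"
        unfolding quotient_def using assms(1) B_S by blast+
      then have "carrier (limit_cohomology \<C> A G n) = {\<one>\<^bsub>limit_cohomology \<C> A G n\<^esub>}"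
        unfolding carr one by (simp only:)
      then show False using nontriv by contradiction
    qed
  qed
qed

end

section \<open>Extending open sets to the compactification\<close>

text \<open>One set is shrunk at a time: \<open>Z\<close> shrinks \<open>W v\<close> around the part
  of \<open>F\<close> that the other sets miss, and \<open>F - Z\<close> is left to the others.
  Hence \<open>F\<close> varies in the induction.\<close>

lemma normal_space_finite_shrinking:
  assumes "normal_space X" "finite V" "\<And>v. v \<in> V \<Longrightarrow> openin X (W v)" "closedin X F" "F \<subseteq> (\<Union>v\<in>V. W v)"
  shows "\<exists>W'. (\<forall>v\<in>V. openin X (W' v) \<and> X closure_of (W' v) \<subseteq> W v) \<and> F \<subseteq> (\<Union>v\<in>V. W' v)"
  using assms(2-)
proof (induction V arbitrary: F)
  case empty
  then show ?case by auto
next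
  case (insert v V)
  have "closedin X (F - (\<Union>u\<in>V. W u))"
    using insert.prems by (intro closedin_diff openin_Union) auto
  then obtain Z where Z: "openin X Z" "F - (\<Union>u\<in>V. W u) \<subseteq> Z" "X closure_of Z \<subseteq> W v"
    using assms(1) insert.prems unfolding normal_space_alt by (metis Diff_subset_conv UN_insert Un_commute insertI1)
  have "closedin X (F - Z)" using Z insert.prems by (intro closedin_diff) auto
  moreover have "F - Z \<subseteq> (\<Union>u\<in>V. W u)" using Z by auto
  ultimately obtain W' where W': "\<forall>u\<in>V. openin X (W' u) \<and> X closure_of (W' u) \<subseteq> W u" "F - Z \<subseteq> (\<Union>u\<in>V. W' u)"
    using insert.IH[of "F - Z"] insert.prems by auto
  show ?case
    by (rule exI[of _ "W'(v := Z)"]) (use insert.hyps W' Z in \<open>auto split: if_splits\<close>)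
qed

text \<open>Abstracts from the construction of the compactification: for normal \<open>S\<close>,
  the condition \<open>disjoint_closures\<close> singles out the Stone-Cech compactification among
  all Hausdorff ones.\<close>

locale stone_cech_pair =
  fixes T :: "'b topology" and S :: "'b set"
  assumes compact: "compact_space T" and Hausdorff: "Hausdorff_space T"
    and dense: "T closure_of S = topspace T" and S_subset: "S \<subseteq> topspace T"
    and disjoint_closures: "\<And>C D. \<lbrakk>closedin (subtopology T S) C; closedin (subtopology T S) D; C \<inter> D = {}\<rbrakk>
        \<Longrightarrow> T closure_of C \<inter> T closure_of D = {}"
begin

lemma normal: "normal_space T"
  using compact Hausdorff compact_Hausdorff_or_regular_imp_normal_space by blast

lemma closedin_imp_compactin: "closedin T K \<Longrightarrow> compactin T K"
  using compact closedin_compact_space by blast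

lemma compactin_imp_closedin: "compactin T K \<Longrightarrow> closedin T K"
  using Hausdorff compactin_imp_closedin by blast

lemma separate_point:
  assumes "closedin T C" "y \<in> topspace T - C"
  obtains N where "openin T N" "y \<in> N" "T closure_of N \<inter> C = {}"
proof -
  have "closedin T {y}" using assms Hausdorff by (simp add: closedin_Hausdorff_singleton)
  moreover have "openin T (topspace T - C)" "{y} \<subseteq> topspace T - C" using assms by auto
  ultimately obtain N where "openin T N" "{y} \<subseteq> N" "T closure_of N \<subseteq> topspace T - C"
    using normal unfolding normal_space_alt by metis
  then show ?thesis using that by blast
qed

text \<open>A point outside the closure of \<open>C \<inter> D\<close> has a closed neighbourhood
  that misses it. Cut down to this neighbourhood, \<open>C\<close> and \<open>D\<close> are disjoint
  and closed in \<open>S\<close>, but their closures would still share the point.\<close>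

lemma closure_of_Int_closed:
  assumes C: "closedin (subtopology T S) C" and D: "closedin (subtopology T S) D"
  shows "T closure_of C \<inter> T closure_of D \<subseteq> T closure_of (C \<inter> D)"
proof (rule ccontr)
  assume "\<not> ?thesis"
  then obtain y where y: "y \<in> T closure_of C" "y \<in> T closure_of D" "y \<notin> T closure_of (C \<inter> D)" by blast
  have "y \<in> topspace T" using y(1) closure_of_subset_topspace by fastforce
  then obtain N where N: "openin T N" "y \<in> N" "T closure_of N \<inter> T closure_of (C \<inter> D) = {}"
    using separate_point[OF closedin_closure_of, of y] y(3) by blast
  let ?N = "T closure_of N"
  have NN: "N \<subseteq> ?N" using N(1) closure_of_subset openin_subset by metis
  have sub: "closedin (subtopology T S) (C \<inter> ?N)" "closedin (subtopology T S) (D \<inter> ?N)"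
  proof -
    have "closedin (subtopology T S) (E \<inter> ?N)" if E: "closedin (subtopology T S) E" for E
    proof -
      have "closedin (subtopology T S) (E \<inter> (S \<inter> ?N))"
        by (intro closedin_Int E closedin_subtopology_Int_closed closedin_closure_of)
      moreover have "E \<subseteq> S" using closedin_subset[OF E] by auto
      ultimately show ?thesis by (simp add: Int_absorb2 flip: Int_assoc)
    qed
    then show "closedin (subtopology T S) (C \<inter> ?N)" "closedin (subtopology T S) (D \<inter> ?N)" using C D by blast+
  qed
  have "C \<subseteq> topspace T" "D \<subseteq> topspace T" using C D closedin_subset by fastforce+
  then have "C \<inter> D \<subseteq> T closure_of (C \<inter> D)" by (intro closure_of_subset) auto
  then have "(C \<inter> ?N) \<inter> (D \<inter> ?N) = {}" using N by blast
  then have "T closure_of (C \<inter> ?N) \<inter> T closure_of (D \<inter> ?N) = {}" using disjoint_closures sub by blast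
  moreover have "y \<in> T closure_of (E \<inter> ?N)" if "y \<in> T closure_of E" for E
  proof -
    have "y \<in> T closure_of (N \<inter> E)" using that N by (metis IntI openin_Int_closure_of_subset subsetD)
    then show ?thesis using closure_of_mono[of "N \<inter> E" "E \<inter> ?N" T] NN by blast
  qed
  ultimately show False using y by blast
qed

definition Ext :: "'b set \<Rightarrow> 'b set" where
  "Ext U = topspace T - T closure_of (S - U)"

lemma openin_Ext [simp]: "openin T (Ext U)"
  by (simp add: Ext_def openin_diff)

lemma Ext_Int_subset: "Ext U \<inter> S \<subseteq> U"
  using closure_of_subset[of "S - U" T] S_subset by (auto simp: Ext_def)

lemma subset_Ext:
  assumes "openin (subtopology T S) U"
  shows "U \<subseteq> Ext U"
proof -
  obtain V where V: "openin T V" "U = V \<inter> S" using assms by (auto simp: openin_subtopology)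
  then have "V \<inter> T closure_of (S - U) = {}" by (auto simp: openin_Int_closure_of_eq_empty)
  then show ?thesis using V openin_subset by (fastforce simp: Ext_def)
qed

lemma Ext_subset_closure: "Ext U \<subseteq> T closure_of U"
proof -
  have "topspace T \<subseteq> T closure_of ((S - U) \<union> U)"
    using closure_of_mono[of S "(S - U) \<union> U" T] unfolding dense by blast
  then show ?thesis unfolding Ext_def closure_of_Un by blast
qed

text \<open>A point of \<open>T\<close> outside \<open>Ext (U v)\<close> lies in the closure of
  \<open>S - U v\<close>, so \<open>closure_of_Int_closed\<close> allows these sets to be
  intersected with \<open>A\<close> one after another. For \<open>A = S\<close> this amounts to
  \<open>Ext\<close> commuting with finite unions.\<close>

lemma closure_of_diff_UN:
  assumes "finite V" "\<And>v. v \<in> V \<Longrightarrow> openin (subtopology T S) (U v)" "closedin (subtopology T S) A"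
    and "y \<in> T closure_of A" "\<And>v. v \<in> V \<Longrightarrow> y \<notin> Ext (U v)"
  shows "y \<in> T closure_of (A - (\<Union>v\<in>V. U v))"
  using assms
proof (induction V)
  case (insert v V)
  have sub: "topspace (subtopology T S) = S" using S_subset by auto
  have y: "y \<in> T closure_of (A - (\<Union>v\<in>V. U v))" using insert by auto
  have "y \<in> T closure_of (S - U v)"
    using insert.prems(3,4) closure_of_subset_topspace[of T A] by (auto simp: Ext_def)
  moreover have "closedin (subtopology T S) (S - U v)"
    using insert.prems(1)[of v] openin_closedin_eq sub by (metis closedin_def double_diff insertI1 openin_subset order_refl Diff_subset)
  moreover have "closedin (subtopology T S) (A - (\<Union>v\<in>V. U v))"
    using insert.prems by (intro closedin_diff openin_Union) auto
  ultimately have "y \<in> T closure_of ((A - (\<Union>v\<in>V. U v)) \<inter> (S - U v))"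
    using closure_of_Int_closed y by blast
  moreover have "(A - (\<Union>v\<in>V. U v)) \<inter> (S - U v) \<subseteq> A - (\<Union>v\<in>insert v V. U v)" by auto
  ultimately show ?case using closure_of_mono by blast
qed simp

text \<open>The intersection of the sets \<open>Ext (U v)\<close> is an open neighbourhood of
  \<open>y\<close>, so it contains a point of \<open>A\<close>; on \<open>S\<close> each
  \<open>Ext (U v)\<close> is contained in \<open>U v\<close>.\<close>

lemma Ext_meets:
  assumes "finite s" "y \<in> T closure_of A" "A \<subseteq> S" "\<And>v. v \<in> s \<Longrightarrow> y \<in> Ext (U v)"
  shows "(\<Inter>v\<in>s. U v) \<inter> A \<noteq> {}"
proof -
  have "openin T (topspace T \<inter> (\<Inter>v\<in>s. Ext (U v)))"
    using assms(1) by (cases "s = {}") (auto intro!: openin_Int openin_INT)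
  moreover have "y \<in> topspace T \<inter> (\<Inter>v\<in>s. Ext (U v))"
    using assms closure_of_subset_topspace[of T A] by auto
  ultimately obtain a where a: "a \<in> A" "a \<in> (\<Inter>v\<in>s. Ext (U v))"
    using assms(2) unfolding in_closure_of by blast
  then have "a \<in> U v" if "v \<in> s" for v
    using that Ext_Int_subset[of "U v"] assms(3) by blast
  then show ?thesis using a(1) by blast
qed

text \<open>A compact subset of a metrizable space has a countable neighbourhood base, and this passes
  to the compactification; hence its complement in \<open>T\<close> is an \<open>F\<^sub>\<sigma>\<close> set.\<close>

lemma normal_space_complement:
  assumes "metrizable_space (subtopology T S)" "closedin T K" "K \<subseteq> S"
  shows "normal_space (subtopology T (topspace T - K))"
proof -
  obtain M d where "Metric_space M d" and eq: "subtopology T S = Metric_space.mtopology M d"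
    using assms(1) by (auto simp: metrizable_space_def)
  then interpret Metric_space M d by simp
  have M: "M = S" using eq S_subset by (metis inf.absorb_iff2 topspace_mtopology topspace_subtopology)
  have "compactin (subtopology T S) K"
    using assms closedin_imp_compactin by (simp add: compactin_subtopology)
  then have K: "compactin mtopology K" by (simp add: eq)
  define O' where "O' n = (\<Union>k\<in>K. mball k (1 / real (Suc n)))" for n
  have O': "openin (subtopology T S) (O' n)" "K \<subseteq> O' n" for n
  proof -
    show "openin (subtopology T S) (O' n)" by (auto simp: O'_def eq intro!: openin_Union)
    have "k \<in> mball k (1 / real (Suc n))" if "k \<in> K" for k
    proof -
      have "k \<in> M" using that assms(3) M by blast
      then show ?thesis by simp
    qed
    then show "K \<subseteq> O' n" unfolding O'_def by blast
  qed
  \<comment> \<open>A point \<open>y\<close> outside \<open>K\<close> has a neighbourhood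
    \<open>N\<close> whose closure misses \<open>K\<close>. A Lebesgue number puts some
    \<open>O' n\<close> inside \<open>S - T closure_of N\<close>; then the closure of
    \<open>O' n\<close>, which contains \<open>Ext (O' n)\<close>, misses \<open>N\<close>.\<close>
  have "(\<Inter>n. Ext (O' n)) \<subseteq> K"
  proof (rule ccontr)
    assume "\<not> ?thesis"
    then obtain y where y: "\<And>n. y \<in> Ext (O' n)" "y \<notin> K" by auto
    then have "y \<in> topspace T - K" by (auto simp: Ext_def)
    then obtain N where N: "openin T N" "y \<in> N" "T closure_of N \<inter> K = {}"
      using separate_point assms(2) by metis
    let ?U = "S - T closure_of N"
    have "openin (subtopology T S) ?U"
      unfolding openin_subtopology using S_subset
      by (intro exI[of _ "topspace T - T closure_of N"]) (auto intro: openin_diff)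
    moreover have "K \<subseteq> ?U" using N(3) assms(3) by blast
    ultimately have "\<exists>e>0. \<forall>x\<in>K. \<exists>V\<in>{?U}. mball x e \<subseteq> V"
      unfolding eq by (intro lebesgue_number[OF K]) simp_all
    then obtain e where e: "e > 0" "\<And>x. x \<in> K \<Longrightarrow> mball x e \<subseteq> ?U" by blast
    obtain n where n: "1 / real (Suc n) < e" using e(1) nat_approx_posE by blast
    have "mball x (1 / real (Suc n)) \<subseteq> ?U" if "x \<in> K" for x
      using e(2)[OF that] mball_subset_concentric[OF less_imp_le[OF n], of x] by (rule subset_trans[rotated])
    then have "O' n \<subseteq> ?U"
      unfolding O'_def by blast
    then have "y \<in> T closure_of (S - T closure_of N)"
      using y(1)[of n] Ext_subset_closure[of "O' n"] closure_of_mono by blast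
    then obtain z where "z \<in> N" "z \<in> S - T closure_of N" using N in_closure_of by metis
    then show False using N(1) closure_of_subset[of N T] openin_subset by blast
  qed
  moreover have "K \<subseteq> Ext (O' n)" for n using O'[of n] subset_Ext by blast
  ultimately have "K = (\<Inter>n. Ext (O' n))" by blast
  moreover have "gdelta_in T (\<Inter>n. Ext (O' n))"
    by (rule gdelta_in_Inter) (auto intro: open_imp_gdelta_in)
  ultimately have "gdelta_in T K" by simp
  \<comment> \<open>The complement of a \<open>G\<^sub>\<delta>\<close> set is an
    \<open>F\<^sub>\<sigma>\<close> set, and \<open>F\<^sub>\<sigma>\<close> subspaces of normal
    spaces are normal.\<close>
  then have "fsigma_in T (topspace T - K)"
    using closedin_subset[OF assms(2)] by (simp add: fsigma_in_gdelta_in double_diff)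
  then show ?thesis by (rule normal_space_fsigma_subtopology[OF normal])
qed

lemma openin_subtopology_Int_S: "openin T W \<Longrightarrow> openin (subtopology T S) (W \<inter> S)"
  by (auto simp: openin_subtopology)

lemma topspace_subtopology_S [simp]: "topspace (subtopology T S) = S"
  using S_subset by auto

text \<open>Here \<open>N\<close> is a neighbourhood of \<open>F - K\<close>.  The point of passing from \<open>W\<close> to \<open>U\<close> is that each simplex of the
  nerve of \<open>U\<close> already has a point of \<open>T - S\<close> in its carrier with respect to \<open>W\<close>.  This is achieved by moving
  the intersections of the closures of the shrunken sets into \<open>K\<close> whenever they are contained in \<open>S\<close>.\<close>

lemma border_shrinking:
  assumes metr: "metrizable_space (subtopology T S)"
    and V: "finite V" "VA \<subseteq> V" and W: "\<And>v. v \<in> V \<Longrightarrow> openin T (W v)"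
    and cover: "topspace T - S \<subseteq> (\<Union>v\<in>V. W v)"
    and F: "closedin T F" "F - S \<subseteq> (\<Union>v\<in>VA. W v)"
  obtains U K N where "closedin T K" "K \<subseteq> S" "\<And>v. v \<in> V \<Longrightarrow> openin (subtopology T S) (U v)"
    "\<And>v. v \<in> V \<Longrightarrow> U v \<subseteq> W v" "\<And>v. v \<in> V \<Longrightarrow> T closure_of U v - S \<subseteq> W v"
    "S - K = (\<Union>v\<in>V. U v)" "openin T N" "F - K \<subseteq> N" "T closure_of N \<inter> S - K \<subseteq> (\<Union>v\<in>VA. U v)"
    "\<And>s. \<lbrakk>s \<subseteq> V; s \<noteq> {}; (\<Inter>v\<in>s. U v) \<noteq> {}\<rbrakk> \<Longrightarrow> \<not> (\<Inter>v\<in>s. W v) \<subseteq> S"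
    "\<And>s. \<lbrakk>s \<subseteq> VA; s \<noteq> {}; (\<Inter>v\<in>s. U v) \<inter> T closure_of N \<noteq> {}\<rbrakk> \<Longrightarrow> \<not> (\<Inter>v\<in>s. W v) \<inter> F \<subseteq> S"
proof -
  have WT: "W v \<subseteq> topspace T" if "v \<in> V" for v using W[OF that] openin_subset by blast
  \<comment> \<open>The points missed by the two coverings. They lie in \<open>S\<close> by
    assumption, so the complement of \<open>K1\<close> is still normal, and there both coverings are
    complete.\<close>
  define K1 where "K1 = (topspace T - (\<Union>v\<in>V. W v)) \<union> (F - (\<Union>v\<in>VA. W v))"
  have "openin T (\<Union>v\<in>V. W v)" "openin T (\<Union>v\<in>VA. W v)"
    using W V(2) by (auto intro!: openin_Union)
  then have K1: "closedin T K1" unfolding K1_def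
    by (intro closedin_Un closedin_diff closedin_topspace F(1))
  have K1S: "K1 \<subseteq> S" using cover F(2) unfolding K1_def by blast
  define T1 where "T1 = subtopology T (topspace T - K1)"
  have T1: "normal_space T1" "topspace T1 = topspace T - K1"
    using normal_space_complement[OF metr K1 K1S] by (auto simp: T1_def)
  have op1: "openin T Z" if "openin T1 Z" for Z
    using that K1 unfolding T1_def by (metis openin_diff openin_open_subtopology openin_topspace)
  \<comment> \<open>Shrinking in \<open>T1\<close> controls closures in \<open>T\<close> only up to
    points of \<open>K1\<close>, which lie in \<open>S\<close>.\<close>
  have cl1: "T closure_of Z - K1 \<subseteq> T1 closure_of Z" if "Z \<subseteq> topspace T1" for Z
  proof -
    have "Z \<subseteq> topspace T - K1" using that T1(2) by simp
    then have "T1 closure_of Z = (topspace T - K1) \<inter> T closure_of Z"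
      unfolding T1_def by (simp add: closure_of_subtopology Int_absorb1)
    then show ?thesis using closure_of_subset_topspace[of T Z] by blast
  qed
  have W1op: "openin T1 (W v - K1)" if "v \<in> V" for v
  proof -
    have "W v - K1 = W v \<inter> (topspace T - K1)" using WT[OF that] by blast
    then show ?thesis using W[OF that] unfolding T1_def openin_subtopology by blast
  qed
  have "topspace T1 \<subseteq> (\<Union>v\<in>V. W v - K1)" using T1(2) by (auto simp: K1_def)
  then have "\<exists>W1. (\<forall>v\<in>V. openin T1 (W1 v) \<and> T1 closure_of (W1 v) \<subseteq> W v - K1) \<and> topspace T1 \<subseteq> (\<Union>v\<in>V. W1 v)"
    by (intro normal_space_finite_shrinking[where W = "\<lambda>v. W v - K1"] T1(1) V(1) W1op closedin_topspace)
  then obtain W1 where W1: "\<And>v. v \<in> V \<Longrightarrow> openin T1 (W1 v)" "\<And>v. v \<in> V \<Longrightarrow> T1 closure_of (W1 v) \<subseteq> W v - K1"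
    "topspace T1 \<subseteq> (\<Union>v\<in>V. W1 v)" by auto
  have "closedin T1 (F - K1)"
  proof -
    have "F - K1 = F \<inter> (topspace T - K1)" using closedin_subset[OF F(1)] by blast
    then show ?thesis using F(1) unfolding T1_def closedin_subtopology by blast
  qed
  moreover have "F - K1 \<subseteq> (\<Union>v\<in>VA. W v - K1)" by (auto simp: K1_def)
  moreover have "finite VA" using V finite_subset by blast
  moreover have "openin T1 (W v - K1)" if "v \<in> VA" for v using that V(2) W1op by blast
  ultimately have "\<exists>W2. (\<forall>v\<in>VA. openin T1 (W2 v) \<and> T1 closure_of (W2 v) \<subseteq> W v - K1) \<and> F - K1 \<subseteq> (\<Union>v\<in>VA. W2 v)"
    by (intro normal_space_finite_shrinking[where W = "\<lambda>v. W v - K1", OF T1(1)])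
  then obtain W2 where W2: "\<And>v. v \<in> VA \<Longrightarrow> openin T1 (W2 v)" "\<And>v. v \<in> VA \<Longrightarrow> T1 closure_of (W2 v) \<subseteq> W v - K1"
    "F - K1 \<subseteq> (\<Union>v\<in>VA. W2 v)" by auto
  \<comment> \<open>The sets of \<open>W1\<close> with index in \<open>VA\<close> need not cover
    \<open>F - K1\<close>. Joining the second shrinking \<open>W2\<close> ensures this and keeps the
    bound on closures.\<close>
  define W' where "W' v = W1 v \<union> (if v \<in> VA then W2 v else {})" for v
  have W'1: "openin T1 (W' v)" "T1 closure_of (W' v) \<subseteq> W v" if "v \<in> V" for v
    using W1(1,2)[OF that] W2(1,2)[of v] by (auto simp: W'_def closure_of_Un)
  have W': "openin T (W' v)" "T closure_of (W' v) - K1 \<subseteq> W v" "W' v \<subseteq> topspace T - K1" if "v \<in> V" for v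
    using op1[OF W'1(1)[OF that]] W'1(2)[OF that] cl1[OF openin_subset[OF W'1(1)[OF that]]]
      openin_subset[OF W'1(1)[OF that]] T1(2) by auto
  have cover': "topspace T - K1 \<subseteq> (\<Union>v\<in>V. W' v)" "F - K1 \<subseteq> (\<Union>v\<in>VA. W' v)"
    using W1(3) W2(3) V(2) T1(2) unfolding W'_def by auto
  define P where "P s = (\<Inter>v\<in>s. T closure_of (W' v))" for s
  \<comment> \<open>The index sets whose carrier with respect to \<open>W\<close> has no point in
    \<open>T - S\<close>, or none in \<open>F - S\<close> for \<open>badA\<close>. For these the
    closed set \<open>P s\<close>, or \<open>P s \<inter> F\<close>, is contained in
    \<open>S\<close> and can be moved into \<open>K\<close>.\<close>
  define bad where "bad = {s. s \<subseteq> V \<and> s \<noteq> {} \<and> (\<Inter>v\<in>s. W v) \<subseteq> S}"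
  define badA where "badA = {s. s \<subseteq> VA \<and> s \<noteq> {} \<and> (\<Inter>v\<in>s. W v) \<inter> F \<subseteq> S}"
  have fin: "finite bad" "finite badA"
    using V by (auto simp: bad_def badA_def intro: finite_subset[of _ "Pow V"] finite_subset[of _ "Pow VA"] finite_subset)
  have Pclosed: "closedin T (P s)" if "s \<noteq> {}" for s using that unfolding P_def by (intro closedin_Inter) auto
  have PW: "P s - K1 \<subseteq> (\<Inter>v\<in>s. W v)" if "s \<subseteq> V" for s using that W'(2) unfolding P_def by blast
  define K where "K = K1 \<union> (\<Union>s\<in>bad. P s) \<union> (\<Union>s\<in>badA. P s \<inter> F)"
  have K: "closedin T K"
    unfolding K_def using fin Pclosed F(1) K1
    by (intro closedin_Un closedin_Union) (auto simp: bad_def badA_def)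
  have "P s \<subseteq> S" if "s \<in> bad" for s
  proof -
    have "s \<subseteq> V" "(\<Inter>v\<in>s. W v) \<subseteq> S" using that by (simp_all add: bad_def)
    then show ?thesis using PW[of s] K1S by blast
  qed
  moreover have "P s \<inter> F \<subseteq> S" if "s \<in> badA" for s
  proof -
    have "s \<subseteq> VA" "(\<Inter>v\<in>s. W v) \<inter> F \<subseteq> S" using that by (simp_all add: badA_def)
    then show ?thesis using PW[of s] K1S V(2) by blast
  qed
  ultimately have KS: "K \<subseteq> S" using K1S unfolding K_def by blast
  \<comment> \<open>The neighbourhood of \<open>F - K\<close> is to be found in the complement of
    the enlarged \<open>K\<close>, so normality is established a second time.\<close>
  define T2 where "T2 = subtopology T (topspace T - K)"
  have T2: "normal_space T2" "topspace T2 = topspace T - K"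
    using normal_space_complement[OF metr K KS] by (auto simp: T2_def)
  have op2: "openin T Z" if "openin T2 Z" for Z
    using that K unfolding T2_def by (metis openin_diff openin_open_subtopology openin_topspace)
  have cl2: "T closure_of Z - K \<subseteq> T2 closure_of Z" if "Z \<subseteq> topspace T2" for Z
  proof -
    have "Z \<subseteq> topspace T - K" using that T2(2) by simp
    then have "T2 closure_of Z = (topspace T - K) \<inter> T closure_of Z"
      unfolding T2_def by (simp add: closure_of_subtopology Int_absorb1)
    then show ?thesis using closure_of_subset_topspace[of T Z] by blast
  qed
  \<comment> \<open>Removing the sets \<open>P s\<close> keeps the simplexes in \<open>badA\<close>
    away from the neighbourhood of \<open>F - K\<close>. No point of \<open>F - K\<close> is lost,
    since \<open>K\<close> contains \<open>P s \<inter> F\<close>.\<close>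
  define Q where "Q = (\<Union>v\<in>VA. W' v) - (\<Union>s\<in>badA. P s)"
  have Q: "openin T Q"
    unfolding Q_def using fin Pclosed W'(1) V(2)
    by (intro openin_diff openin_Union closedin_Union) (auto simp: badA_def)
  have "openin T2 (Q - K)"
  proof -
    have "Q - K = Q \<inter> (topspace T - K)" using openin_subset[OF Q] by blast
    then show ?thesis using Q unfolding T2_def openin_subtopology by blast
  qed
  moreover have "closedin T2 (F - K)"
  proof -
    have "F - K = F \<inter> (topspace T - K)" using closedin_subset[OF F(1)] by blast
    then show ?thesis using F(1) unfolding T2_def closedin_subtopology by blast
  qed
  moreover have "F - K \<subseteq> Q - K" using cover'(2) unfolding K_def Q_def by blast
  ultimately obtain N where N: "openin T2 N" "F - K \<subseteq> N" "T2 closure_of N \<subseteq> Q - K"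
    using T2(1) unfolding normal_space_alt by metis
  have NQ: "T closure_of N - K \<subseteq> Q" using cl2[OF openin_subset[OF N(1)]] N(3) by blast
  define U where "U v = (W' v - K) \<inter> S" for v
  \<comment> \<open>The source of both nerve conditions: a point common to the sets
    \<open>U v\<close> lies in \<open>P s\<close> but not in \<open>K\<close>, which rules out
    \<open>s \<in> bad\<close>, and if it also lies in the closure of \<open>N\<close> it is in
    \<open>Q\<close>, which rules out \<open>s \<in> badA\<close>.\<close>
  have UP: "(\<Inter>v\<in>s. U v) \<subseteq> P s - K" if s: "s \<subseteq> V" "s \<noteq> {}" for s
  proof -
    have "U v \<subseteq> T closure_of W' v - K" if "v \<in> s" for v
    proof -
      have "W' v \<subseteq> T closure_of W' v" using W'(3)[of v] that s by (intro closure_of_subset) auto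
      then show ?thesis by (auto simp: U_def)
    qed
    then show ?thesis using s unfolding P_def by blast
  qed
  show ?thesis
  proof (rule that[of K U N])
    show "closedin T K" "K \<subseteq> S" by fact+
    show "openin T N" using op2[OF N(1)] .
    show "F - K \<subseteq> N" by fact
    show "openin (subtopology T S) (U v)" if "v \<in> V" for v
      unfolding U_def using W'(1)[OF that] K by (intro openin_subtopology_Int_S openin_diff)
    show "T closure_of U v - S \<subseteq> W v" if "v \<in> V" for v
    proof -
      have "T closure_of U v \<subseteq> T closure_of W' v" by (intro closure_of_mono) (auto simp: U_def)
      then show ?thesis using W'(2)[OF that] K1S by blast
    qed
    show "U v \<subseteq> W v" if "v \<in> V" for v
    proof -
      have "W' v \<subseteq> T closure_of W' v" using W'(3)[OF that] by (intro closure_of_subset) auto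
      then show ?thesis using W'(2,3)[OF that] unfolding U_def by blast
    qed
    show "S - K = (\<Union>v\<in>V. U v)"
    proof -
      have "K1 \<subseteq> K" unfolding K_def by blast
      then have "S - K \<subseteq> (\<Union>v\<in>V. W' v)" using cover'(1) S_subset by blast
      then show ?thesis unfolding U_def by auto
    qed
    show "T closure_of N \<inter> S - K \<subseteq> (\<Union>v\<in>VA. U v)"
    proof -
      have "T closure_of N - K \<subseteq> (\<Union>v\<in>VA. W' v)" using NQ unfolding Q_def by blast
      then show ?thesis unfolding U_def by auto
    qed
    show "\<not> (\<Inter>v\<in>s. W v) \<subseteq> S" if "s \<subseteq> V" "s \<noteq> {}" "(\<Inter>v\<in>s. U v) \<noteq> {}" for s
    proof
      assume "(\<Inter>v\<in>s. W v) \<subseteq> S"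
      then have "s \<in> bad" using that by (simp add: bad_def)
      then have "P s \<subseteq> K" unfolding K_def by blast
      then show False using UP[OF that(1,2)] that(3) by blast
    qed
    show "\<not> (\<Inter>v\<in>s. W v) \<inter> F \<subseteq> S" if s: "s \<subseteq> VA" "s \<noteq> {}" "(\<Inter>v\<in>s. U v) \<inter> T closure_of N \<noteq> {}" for s
    proof
      assume "(\<Inter>v\<in>s. W v) \<inter> F \<subseteq> S"
      then have "s \<in> badA" using s by (simp add: badA_def)
      then have "Q \<inter> P s = {}" unfolding Q_def by blast
      moreover obtain x where "x \<in> (\<Inter>v\<in>s. U v)" "x \<in> T closure_of N" using s(3) by blast
      moreover have "s \<subseteq> V" using s(1) V(2) by blast
      ultimately show False using UP[of s] s(2) NQ by blast
    qed
  qed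
qed

end

section \<open>Comparison of the two systems of covers\<close>

context comm_group
begin

text \<open>\<open>c\<close> is restricted to the smaller nerve. If this became a coboundary on some
  \<open>\<beta>'\<close>, restricting further to the \<open>\<beta>\<close> supplied by
  \<open>step\<close> would kill \<open>c\<close> along the same \<open>p\<close>. Only nerves and
  projections are compared, so the families may live on different spaces.\<close>

lemma persistent_cocycle_transfer:
  fixes \<alpha> :: "'x family" and \<alpha>' :: "'y family"
  assumes pers: "persistent_cocycle \<C> A G n \<alpha> c"
    and \<alpha>': "\<alpha>' \<in> \<C>'" "nerve \<alpha>' \<subseteq> nerve \<alpha>" "subnerve A' \<alpha>' \<subseteq> subnerve A \<alpha>"
    and step: "\<And>\<beta>' p. \<lbrakk>\<beta>' \<in> \<C>'; refinement_projection \<alpha>' \<beta>' p\<rbrakk> \<Longrightarrow>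
      \<exists>\<beta>\<in>\<C>. refinement_projection \<alpha> \<beta> p \<and> nerve \<beta> \<subseteq> nerve \<beta>' \<and> subnerve A \<beta> \<subseteq> subnerve A' \<beta>'"
  shows "persistent_cocycle \<C>' A' G n \<alpha>' (cochain_pullback (nerve \<alpha>') n id c)"
proof -
  let ?c = "cochain_pullback (nerve \<alpha>') n id c"
  have incl: "simplicial_pair_map (nerve \<alpha>') (subnerve A' \<alpha>') (nerve \<alpha>) (subnerve A \<alpha>) id"
    using \<alpha>' by (auto simp: simplicial_pair_map_def)
  have c: "c \<in> cocycles (nerve \<alpha>) (subnerve A \<alpha>) G n" using pers by (simp add: persistent_cocycle_def)
  have "?c \<in> cocycles (nerve \<alpha>') (subnerve A' \<alpha>') G n"
    by (rule cocycles_pullback[OF simplex_family_nerve simplex_family_nerve subnerve_subset subnerve_subset incl c])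
  moreover have "cochain_pullback (nerve \<beta>') n p ?c \<notin> coboundaries (nerve \<beta>') (subnerve A' \<beta>') G n"
    if \<beta>': "\<beta>' \<in> \<C>'" and p: "refinement_projection \<alpha>' \<beta>' p" for \<beta>' p
  proof
    assume cob: "cochain_pullback (nerve \<beta>') n p ?c \<in> coboundaries (nerve \<beta>') (subnerve A' \<beta>') G n"
    obtain \<beta> where \<beta>: "\<beta> \<in> \<C>" "refinement_projection \<alpha> \<beta> p" "nerve \<beta> \<subseteq> nerve \<beta>'" "subnerve A \<beta> \<subseteq> subnerve A' \<beta>'"
      using step[OF \<beta>' p] by blast
    have incl': "simplicial_pair_map (nerve \<beta>) (subnerve A \<beta>) (nerve \<beta>') (subnerve A' \<beta>') id"
      using \<beta> by (auto simp: simplicial_pair_map_def)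
    have "cochain_pullback (nerve \<beta>) n id (cochain_pullback (nerve \<beta>') n p ?c) \<in> coboundaries (nerve \<beta>) (subnerve A \<beta>) G n"
      by (rule coboundaries_pullback[OF simplex_family_nerve simplex_family_nerve subnerve_subset subnerve_subset incl' cob])
    then have "cochain_pullback (nerve \<beta>) n p c \<in> coboundaries (nerve \<beta>) (subnerve A \<beta>) G n"
      by (simp add: cochain_pullback_comp[OF simplicial_pair_map_refinement[OF p, of A']] cochain_pullback_comp[OF incl'])
    then show False using pers \<beta>(1,2) by (simp add: persistent_cocycle_def)
  qed
  ultimately show ?thesis using \<alpha>'(1) by (simp add: persistent_cocycle_def)
qed

end

context stone_cech_pair
begin

abbreviation "remainder \<equiv> subtopology T (topspace T - S)"

lemma topspace_remainder [simp]: "topspace remainder = topspace T - S"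
  by auto

definition ext_family :: "'b family \<Rightarrow> 'b family" where
  "ext_family \<alpha> = \<alpha>\<lparr>part := \<lambda>v. Ext (part \<alpha> v) - S\<rparr>"

text \<open>A point in none of the extensions lies in the closure of what the sets
  \<open>U v\<close> leave of \<open>A\<close>. This remains inside the compact set
  \<open>K\<close>, hence inside \<open>S\<close>.\<close>

lemma Ext_cover:
  assumes "finite V" "\<And>v. v \<in> V \<Longrightarrow> openin (subtopology T S) (U v)" "closedin (subtopology T S) A"
    and "compactin (subtopology T S) K" "A - K \<subseteq> (\<Union>v\<in>V. U v)" "y \<in> T closure_of A" "y \<notin> S"
  shows "\<exists>v\<in>V. y \<in> Ext (U v)"
proof (rule ccontr)
  assume "\<not> ?thesis"
  then have "y \<in> T closure_of (A - (\<Union>v\<in>V. U v))"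
    using assms by (intro closure_of_diff_UN) auto
  moreover have "K \<subseteq> S" "closedin T K"
    using assms(4) compactin_imp_closedin by (auto simp: compactin_subtopology)
  then have "T closure_of (A - (\<Union>v\<in>V. U v)) \<subseteq> K"
    using assms(5) by (intro closure_of_minimal) auto
  ultimately show False using \<open>K \<subseteq> S\<close> assms(7) by blast
qed

text \<open>\<open>Ext_cover\<close> is applied to \<open>S\<close> with all indices and to
  \<open>A\<close> with those in \<open>subindex \<alpha>\<close>. \<open>B\<close> may be smaller
  than \<open>T closure_of A - S\<close>, as a prescribed closed set of the remainder need not have
  that form.\<close>

lemma ext_family_finite_open_covers:
  assumes \<alpha>: "\<alpha> \<in> border_covers (subtopology T S) A" and A: "closedin (subtopology T S) A"
    and B: "B \<subseteq> T closure_of A - S"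
  shows "ext_family \<alpha> \<in> finite_open_covers remainder B"
proof -
  obtain K where fin: "finite (index \<alpha>)" "subindex \<alpha> \<subseteq> index \<alpha>"
    and op: "\<And>v. v \<in> index \<alpha> \<Longrightarrow> openin (subtopology T S) (part \<alpha> v)"
    and K: "compactin (subtopology T S) K" "S - K = (\<Union>v\<in>index \<alpha>. part \<alpha> v)"
      "A - K \<subseteq> (\<Union>v\<in>subindex \<alpha>. part \<alpha> v)"
    using \<alpha> by (auto simp: border_covers_def finite_family_def Int_absorb1[OF S_subset])
  have "closedin (subtopology T S) S"
    using closedin_topspace[of "subtopology T S"] by (simp only: topspace_subtopology_S)
  then have "\<exists>v\<in>index \<alpha>. y \<in> Ext (part \<alpha> v)" if "y \<in> topspace T - S" for y
    by (rule Ext_cover[of _ _ S K, rotated 2]) (use that op fin K dense in auto)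
  moreover have "\<exists>v\<in>subindex \<alpha>. y \<in> Ext (part \<alpha> v)" if "y \<in> B" for y
    by (rule Ext_cover[OF _ _ A K(1)])
       (use that op fin K B in \<open>auto intro: finite_subset\<close>)
  moreover have "openin remainder (Ext U - S)" for U
  proof -
    have "Ext U - S = Ext U \<inter> (topspace T - S)" by (auto simp: Ext_def)
    then show ?thesis using openin_Ext unfolding openin_subtopology by blast
  qed
  moreover have "(\<Union>v\<in>index \<alpha>. Ext (part \<alpha> v) - S) \<subseteq> topspace T - S" by (auto simp: Ext_def)
  ultimately show ?thesis
    using fin B unfolding finite_open_covers_def ext_family_def finite_family_def topspace_remainder
    by (simp add: subset_antisym subset_iff)
qed

lemma Ext_Car_meets:
  assumes "finite s" "s \<noteq> {}" "Car (ext_family \<alpha>) s \<inter> T closure_of A \<noteq> {}" "A \<subseteq> S"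
  shows "Car \<alpha> s \<inter> A \<noteq> {}"
proof -
  obtain y where "y \<in> T closure_of A" "\<And>v. v \<in> s \<Longrightarrow> y \<in> Ext (part \<alpha> v)"
    using assms(2,3) by (auto simp: Car_def ext_family_def)
  then show ?thesis using Ext_meets[OF assms(1) _ assms(4)] unfolding Car_def by blast
qed

lemma nerve_ext_family: "nerve (ext_family \<alpha>) \<subseteq> nerve \<alpha>"
proof
  fix s assume "s \<in> nerve (ext_family \<alpha>)"
  then have s: "s \<noteq> {}" "finite s" "s \<subseteq> index \<alpha>" "Car (ext_family \<alpha>) s \<noteq> {}"
    by (auto simp: nerve_def ext_family_def)
  have "Car (ext_family \<alpha>) s \<subseteq> topspace T"
    using s(1) by (auto simp: Car_def ext_family_def Ext_def)
  \<comment> \<open>The nerve is treated as the subnerve over \<open>S\<close>, whose closure is all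
    of \<open>T\<close>.\<close>
  then have "Car (ext_family \<alpha>) s \<inter> T closure_of S \<noteq> {}" using s(4) dense by auto
  then have "Car \<alpha> s \<inter> S \<noteq> {}" by (rule Ext_Car_meets[OF s(2,1) _ subset_refl])
  then show "s \<in> nerve \<alpha>" using s by (auto simp: nerve_def)
qed

lemma subnerve_ext_family:
  assumes "B \<subseteq> T closure_of A" "A \<subseteq> S"
  shows "subnerve B (ext_family \<alpha>) \<subseteq> subnerve A \<alpha>"
proof
  fix s assume s: "s \<in> subnerve B (ext_family \<alpha>)"
  then have n: "s \<in> nerve (ext_family \<alpha>)" "s \<subseteq> subindex \<alpha>" "Car (ext_family \<alpha>) s \<inter> B \<noteq> {}"
    by (auto simp: subnerve_def ext_family_def)
  then have "finite s" "s \<noteq> {}" by (auto simp: nerve_def)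
  moreover have "Car (ext_family \<alpha>) s \<inter> T closure_of A \<noteq> {}" using n(3) assms(1) by blast
  ultimately have "Car \<alpha> s \<inter> A \<noteq> {}" using Ext_Car_meets assms(2) by blast
  moreover have "s \<in> nerve \<alpha>" using n(1) nerve_ext_family by blast
  ultimately show "s \<in> subnerve A \<alpha>" using n(2) by (simp add: subnerve_def)
qed

lemma finite_open_cover_lift:
  assumes "\<beta> \<in> finite_open_covers remainder B"
  obtains W where "\<And>v. v \<in> index \<beta> \<Longrightarrow> openin T (W v)" "\<And>v. v \<in> index \<beta> \<Longrightarrow> W v - S = part \<beta> v"
proof -
  have "\<exists>W. openin T W \<and> W - S = part \<beta> v" if v: "v \<in> index \<beta>" for v
  proof -
    have "openin remainder (part \<beta> v)" using assms v unfolding finite_open_covers_def mem_Collect_eq by blast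
    then obtain W where W: "openin T W" "part \<beta> v = W \<inter> (topspace T - S)"
      unfolding openin_subtopology by (elim exE conjE)
    have "W - S = part \<beta> v" unfolding W(2) using openin_subset[OF W(1)] by blast
    then show ?thesis using W(1) by (intro exI[of _ W] conjI)
  qed
  then have "\<forall>v\<in>index \<beta>. \<exists>W. openin T W \<and> W - S = part \<beta> v" by (rule ballI)
  then have "\<exists>W. \<forall>v\<in>index \<beta>. openin T (W v) \<and> W v - S = part \<beta> v" by (rule bchoice)
  then obtain W where W: "\<forall>v\<in>index \<beta>. openin T (W v) \<and> W v - S = part \<beta> v"
    by (rule exE)
  show ?thesis
  proof (rule that)
    show "openin T (W v)" if "v \<in> index \<beta>" for v using bspec[OF W that] by (rule conjunct1)
    show "W v - S = part \<beta> v" if "v \<in> index \<beta>" for v using bspec[OF W that] by (rule conjunct2)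
  qed
qed

text \<open>\<open>border_shrinking\<close> for families, with \<open>A\<close> the trace on
  \<open>S\<close> of the closure of \<open>N\<close>. The bound on \<open>F\<close> serves when
  \<open>F\<close> is the closure of a given closed subset of \<open>S\<close>;
  \<open>B \<subseteq> T closure_of A\<close> and the bound on closures of \<open>U v\<close> serve
  to return to the remainder.\<close>

lemma border_cover_of_lift:
  assumes metr: "metrizable_space (subtopology T S)"
    and \<beta>: "\<beta> \<in> finite_open_covers remainder B" and F: "closedin T F" "B = F - S"
    and W: "\<And>v. v \<in> index \<beta> \<Longrightarrow> openin T (W v)" "\<And>v. v \<in> index \<beta> \<Longrightarrow> W v - S = part \<beta> v"
  obtains A U where "closedin (subtopology T S) A" "F \<inter> (\<Union>v\<in>index \<beta>. U v) \<subseteq> A" "B \<subseteq> T closure_of A"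
    "\<beta>\<lparr>part := U\<rparr> \<in> border_covers (subtopology T S) A"
    "nerve (\<beta>\<lparr>part := U\<rparr>) \<subseteq> nerve \<beta>" "subnerve A (\<beta>\<lparr>part := U\<rparr>) \<subseteq> subnerve B \<beta>"
    "\<And>v. v \<in> index \<beta> \<Longrightarrow> U v \<subseteq> W v \<inter> S" "\<And>v. v \<in> index \<beta> \<Longrightarrow> T closure_of U v - S \<subseteq> W v"
proof -
  have fin: "finite (index \<beta>)" "subindex \<beta> \<subseteq> index \<beta>"
    and cov: "(\<Union>v\<in>index \<beta>. part \<beta> v) = topspace T - S" "B \<subseteq> (\<Union>v\<in>subindex \<beta>. part \<beta> v)"
    using \<beta> unfolding finite_open_covers_def finite_family_def topspace_remainder mem_Collect_eq by blast+
  have pW: "part \<beta> v \<subseteq> W v" if "v \<in> index \<beta>" for v using W(2)[OF that] by blast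
  have cov1: "topspace T - S \<subseteq> (\<Union>v\<in>index \<beta>. W v)"
    unfolding cov(1)[symmetric] by (rule UN_mono[OF order_refl pW])
  have "(\<Union>v\<in>subindex \<beta>. part \<beta> v) \<subseteq> (\<Union>v\<in>subindex \<beta>. W v)"
    by (rule UN_mono[OF order_refl pW[OF subsetD[OF fin(2)]]])
  then have cov2: "F - S \<subseteq> (\<Union>v\<in>subindex \<beta>. W v)"
    unfolding F(2)[symmetric] using cov(2) by (rule subset_trans[rotated])
  show ?thesis
  proof (rule border_shrinking[OF metr fin W(1) cov1 F(1) cov2])
    fix U K N
    assume K: "closedin T K" "K \<subseteq> S" and U: "\<And>v. v \<in> index \<beta> \<Longrightarrow> openin (subtopology T S) (U v)"
      "\<And>v. v \<in> index \<beta> \<Longrightarrow> U v \<subseteq> W v" "\<And>v. v \<in> index \<beta> \<Longrightarrow> T closure_of U v - S \<subseteq> W v"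
      and UK: "S - K = (\<Union>v\<in>index \<beta>. U v)" and N: "openin T N" "F - K \<subseteq> N" "T closure_of N \<inter> S - K \<subseteq> (\<Union>v\<in>subindex \<beta>. U v)"
      and s1: "\<And>s. \<lbrakk>s \<subseteq> index \<beta>; s \<noteq> {}; (\<Inter>v\<in>s. U v) \<noteq> {}\<rbrakk> \<Longrightarrow> \<not> (\<Inter>v\<in>s. W v) \<subseteq> S"
      and s2: "\<And>s. \<lbrakk>s \<subseteq> subindex \<beta>; s \<noteq> {}; (\<Inter>v\<in>s. U v) \<inter> T closure_of N \<noteq> {}\<rbrakk> \<Longrightarrow> \<not> (\<Inter>v\<in>s. W v) \<inter> F \<subseteq> S"
    define A where "A = T closure_of N \<inter> S"
    have NA: "N \<subseteq> T closure_of N" by (rule closure_of_subset[OF openin_subset[OF N(1)]])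
    show ?thesis
    proof (rule that[of A U])
      show "closedin (subtopology T S) A"
        unfolding A_def closedin_subtopology by (intro exI[of _ "T closure_of N"]) simp
      show "F \<inter> (\<Union>v\<in>index \<beta>. U v) \<subseteq> A"
        using N(2) NA unfolding UK[symmetric] A_def by blast
      show "B \<subseteq> T closure_of A"
      proof
        fix y assume "y \<in> B"
        then have "y \<in> F" "y \<notin> S" by (simp_all add: F(2))
        then have "y \<in> N" "y \<in> topspace T" using K(2) N(2) closedin_subset[OF F(1)] by blast+
        \<comment> \<open>\<open>N\<close> is open and \<open>S\<close> is dense, so points of
          \<open>N\<close> are in the closure of \<open>N \<inter> S\<close>.\<close>
        then have "y \<in> N \<inter> T closure_of S" by (simp add: dense)
        then have "y \<in> T closure_of (N \<inter> S)" by (rule subsetD[OF openin_Int_closure_of_subset[OF N(1)]])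
        moreover have "T closure_of (N \<inter> S) \<subseteq> T closure_of A" using NA unfolding A_def by (intro closure_of_mono Int_mono) simp_all
        ultimately show "y \<in> T closure_of A" by blast
      qed
      have "compactin (subtopology T S) K" using K closedin_imp_compactin by (simp add: compactin_subtopology)
      moreover have "A - K \<subseteq> (\<Union>v\<in>subindex \<beta>. U v)" using N(3) by (simp add: A_def)
      ultimately show "\<beta>\<lparr>part := U\<rparr> \<in> border_covers (subtopology T S) A"
        using fin U(1) UK by (auto simp: border_covers_def finite_family_def Int_absorb1[OF S_subset])
      \<comment> \<open>Outside \<open>S\<close> the sets \<open>W v\<close> agree with the parts of
        \<open>\<beta>\<close>; this turns the points found in \<open>T - S\<close> into points of
        carriers of \<open>\<beta>\<close>.\<close>
      have *: "y \<in> Car \<beta> s" if "y \<in> (\<Inter>v\<in>s. W v)" "y \<notin> S" "s \<subseteq> index \<beta>" for y s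
        unfolding Car_def
      proof (rule INT_I)
        fix v assume "v \<in> s"
        then show "y \<in> part \<beta> v" using that W(2)[of v] by blast
      qed
      have N1: "s \<in> nerve \<beta>" if "s \<in> nerve (\<beta>\<lparr>part := U\<rparr>)" for s
      proof -
        have s: "s \<noteq> {}" "finite s" "s \<subseteq> index \<beta>" "(\<Inter>v\<in>s. U v) \<noteq> {}"
          using that by (auto simp: nerve_def Car_def)
        then obtain y where "y \<in> (\<Inter>v\<in>s. W v)" "y \<notin> S" using s1[of s] by blast
        then have "Car \<beta> s \<noteq> {}" using *[of y s] s(3) by blast
        then show ?thesis using s by (simp add: nerve_def)
      qed
      then show "nerve (\<beta>\<lparr>part := U\<rparr>) \<subseteq> nerve \<beta>" by blast
      show "subnerve A (\<beta>\<lparr>part := U\<rparr>) \<subseteq> subnerve B \<beta>"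
      proof
        fix s assume "s \<in> subnerve A (\<beta>\<lparr>part := U\<rparr>)"
        then have s: "s \<in> nerve (\<beta>\<lparr>part := U\<rparr>)" "s \<subseteq> subindex \<beta>" "(\<Inter>v\<in>s. U v) \<inter> A \<noteq> {}"
          by (auto simp: subnerve_def Car_def)
        then have "s \<noteq> {}" by (auto simp: nerve_def)
        moreover have "(\<Inter>v\<in>s. U v) \<inter> T closure_of N \<noteq> {}" using s(3) unfolding A_def by blast
        ultimately have "\<not> (\<Inter>v\<in>s. W v) \<inter> F \<subseteq> S" using s2[of s] s(2) by blast
        then obtain y where y: "y \<in> (\<Inter>v\<in>s. W v)" "y \<in> F" "y \<notin> S" by blast
        then have "y \<in> Car \<beta> s" using *[of y s] s(2) fin(2) by blast
        moreover have "y \<in> B" using y by (simp add: F(2))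
        ultimately have "Car \<beta> s \<inter> B \<noteq> {}" by blast
        then show "s \<in> subnerve B \<beta>" using N1 s by (simp add: subnerve_def)
      qed
      show "U v \<subseteq> W v \<inter> S" if "v \<in> index \<beta>" for v
        using U(2)[OF that] openin_subset[OF U(1)[OF that]] by auto
      show "T closure_of U v - S \<subseteq> W v" if "v \<in> index \<beta>" for v using U(3)[OF that] .
    qed
  qed
qed

text \<open>A cover \<open>\<beta>\<close> that refines \<open>ext_family \<alpha>\<close> is lifted
  to a border cover that refines \<open>\<alpha>\<close> along the same projection, so
  \<open>persistent_cocycle_transfer\<close> applies.\<close>

lemma persistent_ext_family:
  fixes G :: "('g, 'm) monoid_scheme"
  assumes G: "comm_group G" and metr: "metrizable_space (subtopology T S)"
    and A: "closedin (subtopology T S) A"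
    and pers: "persistent_cocycle (border_covers (subtopology T S) A) A G n \<alpha> c"
  shows "persistent_cocycle (finite_open_covers remainder (T closure_of A - S)) (T closure_of A - S) G n
           (ext_family \<alpha>) (cochain_pullback (nerve (ext_family \<alpha>)) n id c)"
proof (rule comm_group.persistent_cocycle_transfer[OF G pers])
  let ?F = "T closure_of A" and ?B = "T closure_of A - S"
  have AS: "A \<subseteq> S" using closedin_subset[OF A] by auto
  have AF: "A \<subseteq> ?F" using AS S_subset by (intro closure_of_subset) auto
  have \<alpha>: "\<alpha> \<in> border_covers (subtopology T S) A" using pers by (simp add: persistent_cocycle_def)
  then show "ext_family \<alpha> \<in> finite_open_covers remainder ?B"
    by (rule ext_family_finite_open_covers[OF _ A order_refl])
  show "nerve (ext_family \<alpha>) \<subseteq> nerve \<alpha>" by (rule nerve_ext_family)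
  show "subnerve ?B (ext_family \<alpha>) \<subseteq> subnerve A \<alpha>" by (rule subnerve_ext_family[OF _ AS]) blast
  fix \<beta> p assume \<beta>: "\<beta> \<in> finite_open_covers remainder ?B" and p: "refinement_projection (ext_family \<alpha>) \<beta> p"
  have part: "part \<beta> v \<subseteq> Ext (part \<alpha> (p v)) - S" if "v \<in> index \<beta>" for v
    using p that by (simp add: refinement_projection_def ext_family_def)
  obtain W where W: "\<And>v. v \<in> index \<beta> \<Longrightarrow> openin T (W v)" "\<And>v. v \<in> index \<beta> \<Longrightarrow> W v - S = part \<beta> v"
    by (rule finite_open_cover_lift[OF \<beta>]) rule
  \<comment> \<open>The trace on \<open>T - S\<close> is unchanged, since
    \<open>part \<beta> v\<close> already lies in the extension, but the trace on \<open>S\<close>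
    is now contained in \<open>part \<alpha> (p v)\<close>.\<close>
  define W' where "W' v = W v \<inter> Ext (part \<alpha> (p v))" for v
  have W': "openin T (W' v)" "W' v - S = part \<beta> v" if "v \<in> index \<beta>" for v
    using W[OF that] part[OF that] unfolding W'_def by (simp add: openin_Int, blast)
  show "\<exists>\<gamma>\<in>border_covers (subtopology T S) A. refinement_projection \<alpha> \<gamma> p \<and> nerve \<gamma> \<subseteq> nerve \<beta> \<and>
          subnerve A \<gamma> \<subseteq> subnerve ?B \<beta>"
  proof (rule border_cover_of_lift[OF metr \<beta> closedin_closure_of refl W'])
    fix A' U
    let ?\<gamma> = "\<beta>\<lparr>part := U\<rparr>"
    assume A': "?F \<inter> (\<Union>v\<in>index \<beta>. U v) \<subseteq> A'"
      and \<gamma>: "?\<gamma> \<in> border_covers (subtopology T S) A'" "nerve ?\<gamma> \<subseteq> nerve \<beta>" "subnerve A' ?\<gamma> \<subseteq> subnerve ?B \<beta>"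
      and U: "\<And>v. v \<in> index \<beta> \<Longrightarrow> U v \<subseteq> W' v \<inter> S"
    obtain K where K: "compactin (subtopology T S) K" "topspace (subtopology T S) - K = (\<Union>v\<in>index \<beta>. U v)"
      "A' - K \<subseteq> (\<Union>v\<in>subindex \<beta>. U v)"
      using \<gamma>(1) by (auto simp: border_covers_def)
    have fin: "finite_family ?\<gamma>" "\<forall>v\<in>index \<beta>. openin (subtopology T S) (U v)" "subindex \<beta> \<subseteq> index \<beta>"
      using \<gamma>(1) by (auto simp: border_covers_def finite_family_def)
    \<comment> \<open>The lift is a border cover for \<open>A'\<close>, which contains
      \<open>A\<close> up to points of \<open>K\<close>. So it is one for \<open>A\<close> with the
      same \<open>K\<close>, and the subnerve over \<open>A\<close> is no larger.\<close>
    have AA': "A \<inter> (\<Union>v\<in>index \<beta>. U v) \<subseteq> A'" using A' AF by blast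
    have "A - K \<subseteq> A' - K"
      using AA' AS unfolding K(2)[symmetric] topspace_subtopology_S by blast
    then have "A - K \<subseteq> (\<Union>v\<in>subindex \<beta>. U v)" using K(3) by (rule subset_trans)
    then have "?\<gamma> \<in> border_covers (subtopology T S) A"
      using fin K unfolding border_covers_def by (intro CollectI conjI exI[of _ K]) simp_all
    moreover have "refinement_projection \<alpha> ?\<gamma> p"
    proof -
      have "U v \<subseteq> part \<alpha> (p v)" if "v \<in> index \<beta>" for v
        using U[OF that] Ext_Int_subset[of "part \<alpha> (p v)"] unfolding W'_def by blast
      then show ?thesis using p by (simp add: refinement_projection_def ext_family_def)
    qed
    moreover have "subnerve A ?\<gamma> \<subseteq> subnerve A' ?\<gamma>"
    proof
      fix s assume s: "s \<in> subnerve A ?\<gamma>"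
      then have "s \<noteq> {}" "s \<subseteq> index \<beta>" by (auto simp: subnerve_def nerve_def)
      then have "Car ?\<gamma> s \<subseteq> (\<Union>v\<in>index \<beta>. U v)" by (auto simp: Car_def)
      then have "Car ?\<gamma> s \<inter> A \<subseteq> A'" using AA' by blast
      then show "s \<in> subnerve A' ?\<gamma>" using s unfolding subnerve_def by blast
    qed
    ultimately show ?thesis using \<gamma>(2,3) by blast
  qed
qed

text \<open>The subnerve of the lifted family over \<open>A\<close> lies in that of
  \<open>\<alpha>\<close> over \<open>B\<close>, so \<open>c\<close> restricts to a relative cocycle
  for \<open>A\<close>. Border covers refining the lift are sent back by \<open>ext_family\<close>,
  as covers for \<open>B\<close> itself.\<close>

lemma persistent_lift:
  fixes G :: "('g, 'm) monoid_scheme"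
  assumes G: "comm_group G" and metr: "metrizable_space (subtopology T S)"
    and B: "closedin remainder B"
    and pers: "persistent_cocycle (finite_open_covers remainder B) B G n \<alpha> c"
  shows "\<exists>A. closedin (subtopology T S) A \<and> (\<exists>\<alpha>' c'. persistent_cocycle (border_covers (subtopology T S) A) A G n \<alpha>' c')"
proof -
  obtain F where F: "closedin T F" "B = F \<inter> (topspace T - S)" using B by (auto simp: closedin_subtopology)
  have BF: "B = F - S" unfolding F(2) using closedin_subset[OF F(1)] by blast
  have \<alpha>: "\<alpha> \<in> finite_open_covers remainder B" using pers by (simp add: persistent_cocycle_def)
  obtain W where W: "\<And>v. v \<in> index \<alpha> \<Longrightarrow> openin T (W v)" "\<And>v. v \<in> index \<alpha> \<Longrightarrow> W v - S = part \<alpha> v"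
    by (rule finite_open_cover_lift[OF \<alpha>]) rule
  show ?thesis
  proof (rule border_cover_of_lift[OF metr \<alpha> F(1) BF W])
    fix A U
    let ?\<alpha> = "\<alpha>\<lparr>part := U\<rparr>"
    assume A: "closedin (subtopology T S) A" and BA: "B \<subseteq> T closure_of A"
      and U: "?\<alpha> \<in> border_covers (subtopology T S) A" "nerve ?\<alpha> \<subseteq> nerve \<alpha>" "subnerve A ?\<alpha> \<subseteq> subnerve B \<alpha>"
      and clU: "\<And>v. v \<in> index \<alpha> \<Longrightarrow> T closure_of U v - S \<subseteq> W v"
    have AS: "A \<subseteq> S" using closedin_subset[OF A] by auto
    have BAS: "B \<subseteq> T closure_of A - S" using BA BF by blast
    have "persistent_cocycle (border_covers (subtopology T S) A) A G n ?\<alpha> (cochain_pullback (nerve ?\<alpha>) n id c)"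
    proof (rule comm_group.persistent_cocycle_transfer[OF G pers U])
      fix \<beta> p assume \<beta>: "\<beta> \<in> border_covers (subtopology T S) A" and p: "refinement_projection ?\<alpha> \<beta> p"
      have "refinement_projection \<alpha> (ext_family \<beta>) p"
      proof -
        have idx: "p ` index \<beta> \<subseteq> index \<alpha>" "p ` subindex \<beta> \<subseteq> subindex \<alpha>"
          and sub: "\<And>v. v \<in> index \<beta> \<Longrightarrow> part \<beta> v \<subseteq> U (p v)"
          using p by (auto simp: refinement_projection_def)
        \<comment> \<open>\<open>Ext\<close> stays within the closure, and outside \<open>S\<close>
          the closure of \<open>U (p v)\<close> is contained in \<open>W (p v)\<close>, whose trace
          there is \<open>part \<alpha> (p v)\<close>.\<close>
        have "Ext (part \<beta> v) - S \<subseteq> part \<alpha> (p v)" if "v \<in> index \<beta>" for v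
        proof -
          have "p v \<in> index \<alpha>" using that idx by blast
          moreover have "Ext (part \<beta> v) \<subseteq> T closure_of U (p v)"
            using Ext_subset_closure closure_of_mono[OF sub[OF that]] by (rule subset_trans)
          ultimately show ?thesis using clU[of "p v"] W(2)[of "p v"] by blast
        qed
        then show ?thesis using idx by (simp add: refinement_projection_def ext_family_def)
      qed
      moreover have "ext_family \<beta> \<in> finite_open_covers remainder B"
        by (rule ext_family_finite_open_covers[OF \<beta> A BAS])
      moreover have "nerve (ext_family \<beta>) \<subseteq> nerve \<beta>" by (rule nerve_ext_family)
      moreover have "subnerve B (ext_family \<beta>) \<subseteq> subnerve A \<beta>" by (rule subnerve_ext_family[OF BA AS])
      ultimately show "\<exists>\<gamma>\<in>finite_open_covers remainder B. refinement_projection \<alpha> \<gamma> p \<and> nerve \<gamma> \<subseteq> nerve \<beta> \<and>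
          subnerve B \<gamma> \<subseteq> subnerve A \<beta>" by blast
    qed
    then show ?thesis using A by blast
  qed
qed

end

section \<open>Transport of border covers along homeomorphisms\<close>

definition image_family :: "('a \<Rightarrow> 'b) \<Rightarrow> 'a family \<Rightarrow> 'b family" where
  "image_family f \<alpha> = \<lparr>index = index \<alpha>, subindex = subindex \<alpha>, part = \<lambda>v. f ` part \<alpha> v\<rparr>"

lemma image_family_simps [simp]:
  "index (image_family f \<alpha>) = index \<alpha>" "subindex (image_family f \<alpha>) = subindex \<alpha>"
  "part (image_family f \<alpha>) v = f ` part \<alpha> v"
  by (simp_all add: image_family_def)

text \<open>Injectivity makes images commute with intersections; \<open>s = {}\<close> is excluded
  because its carrier is the whole type.\<close>

lemma Car_image_family:
  assumes "inj_on f D" "\<And>v. v \<in> s \<Longrightarrow> part \<alpha> v \<subseteq> D" "s \<noteq> {}"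
  shows "Car (image_family f \<alpha>) s = f ` Car \<alpha> s"
proof -
  obtain v where "v \<in> s" using assms(3) by blast
  then show ?thesis using image_INT[OF assms(1), of s "part \<alpha>"] assms(2) unfolding Car_def by auto
qed

lemma nerve_image_family:
  assumes "inj_on f D" "\<And>v. v \<in> index \<alpha> \<Longrightarrow> part \<alpha> v \<subseteq> D"
  shows "nerve (image_family f \<alpha>) = nerve \<alpha>"
proof -
  have "Car (image_family f \<alpha>) s = f ` Car \<alpha> s" if "s \<noteq> {}" "s \<subseteq> index \<alpha>" for s
    by (rule Car_image_family[OF assms(1) assms(2)[OF subsetD[OF that(2)]] that(1)])
  then show ?thesis unfolding nerve_def by auto
qed

lemma subnerve_image_family:
  assumes "inj_on f D" "\<And>v. v \<in> index \<alpha> \<Longrightarrow> part \<alpha> v \<subseteq> D" "A \<subseteq> D"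
  shows "subnerve (f ` A) (image_family f \<alpha>) = subnerve A \<alpha>"
proof -
  have N: "nerve (image_family f \<alpha>) = nerve \<alpha>" by (rule nerve_image_family[OF assms(1,2)])
  have "Car (image_family f \<alpha>) s \<inter> f ` A = f ` (Car \<alpha> s \<inter> A)" if "s \<in> nerve \<alpha>" for s
  proof -
    have s: "s \<noteq> {}" "s \<subseteq> index \<alpha>" using that by (auto simp: nerve_def)
    then obtain v where "v \<in> s" by blast
    then have "Car \<alpha> s \<subseteq> D" using assms(2)[of v] s(2) by (auto simp: Car_def)
    then show ?thesis
      using Car_image_family[OF assms(1) assms(2)[OF subsetD[OF s(2)]] s(1)] inj_on_image_Int[OF assms(1) _ assms(3)] by simp
  qed
  then show ?thesis unfolding subnerve_def N by auto
qed

lemma image_family_border_covers: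
  assumes f: "homeomorphic_map X Y f" and "\<alpha> \<in> border_covers X A" "A \<subseteq> topspace X"
  shows "image_family f \<alpha> \<in> border_covers Y (f ` A)"
proof -
  obtain K where K: "compactin X K" "topspace X - K = (\<Union>v\<in>index \<alpha>. part \<alpha> v)" "A - K \<subseteq> (\<Union>v\<in>subindex \<alpha>. part \<alpha> v)"
    and fin: "finite_family \<alpha>" "\<And>v. v \<in> index \<alpha> \<Longrightarrow> openin X (part \<alpha> v)"
    using assms(2) by (auto simp: border_covers_def)
  note inj = homeomorphic_imp_injective_map[OF f] and surj = homeomorphic_imp_surjective_map[OF f]
  have KX: "K \<subseteq> topspace X" using K(1) compactin_subset_topspace by blast
  have "compactin Y (f ` K)" using image_compactin[OF K(1) homeomorphic_imp_continuous_map[OF f]] .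
  moreover have "topspace Y - f ` K = (\<Union>v\<in>index \<alpha>. f ` part \<alpha> v)"
    using inj_on_image_set_diff[OF inj Diff_subset KX] by (simp add: surj K(2) image_UN)
  moreover have "f ` A - f ` K \<subseteq> (\<Union>v\<in>subindex \<alpha>. f ` part \<alpha> v)"
    using K(3) by blast
  moreover have "openin Y (f ` part \<alpha> v)" if "v \<in> index \<alpha>" for v
    using homeomorphic_imp_open_map[OF f] fin(2)[OF that] by (simp add: open_map_def)
  ultimately show ?thesis
    using fin(1) unfolding border_covers_def finite_family_def
    by (intro CollectI conjI exI[of _ "f ` K"]) simp_all
qed

lemma border_cover_part: "\<alpha> \<in> border_covers X A \<Longrightarrow> v \<in> index \<alpha> \<Longrightarrow> part \<alpha> v \<subseteq> topspace X"
  using openin_subset by (auto simp: border_covers_def)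

text \<open>Images under a homeomorphism keep indices and, by injectivity, nerves; covers of
  \<open>Y\<close> are carried back by \<open>g\<close>.\<close>

lemma (in comm_group) persistent_image_family:
  assumes fg: "homeomorphic_maps X Y f g" and A: "A \<subseteq> topspace X"
    and pers: "persistent_cocycle (border_covers X A) A G n \<alpha> c"
  shows "persistent_cocycle (border_covers Y (f ` A)) (f ` A) G n (image_family f \<alpha>)
           (cochain_pullback (nerve (image_family f \<alpha>)) n id c)"
proof (rule persistent_cocycle_transfer[OF pers])
  have f: "homeomorphic_map X Y f" and g: "homeomorphic_map Y X g"
    and gf: "\<And>x. x \<in> topspace X \<Longrightarrow> g (f x) = x"
    using fg by (auto simp: homeomorphic_maps_map)
  note inj = homeomorphic_imp_injective_map
  have \<alpha>: "\<alpha> \<in> border_covers X A" using pers by (simp add: persistent_cocycle_def)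
  show "image_family f \<alpha> \<in> border_covers Y (f ` A)"
    by (rule image_family_border_covers[OF f \<alpha> A])
  show "nerve (image_family f \<alpha>) \<subseteq> nerve \<alpha>"
    by (rule equalityD1[OF nerve_image_family[OF inj[OF f] border_cover_part[OF \<alpha>]]])
  show "subnerve (f ` A) (image_family f \<alpha>) \<subseteq> subnerve A \<alpha>"
    by (rule equalityD1[OF subnerve_image_family[OF inj[OF f] border_cover_part[OF \<alpha>] A]])
  fix \<beta> p assume \<beta>: "\<beta> \<in> border_covers Y (f ` A)" and p: "refinement_projection (image_family f \<alpha>) \<beta> p"
  have fA: "f ` A \<subseteq> topspace Y" using A homeomorphic_imp_surjective_map[OF f] by blast
  have gfD: "g ` f ` D = D" if "D \<subseteq> topspace X" for D
    using that gf by (force simp: image_image)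
  have 1: "image_family g \<beta> \<in> border_covers X A"
    using image_family_border_covers[OF g \<beta> fA] by (simp only: gfD[OF A])
  have 2: "nerve (image_family g \<beta>) = nerve \<beta>"
    by (rule nerve_image_family[OF inj[OF g] border_cover_part[OF \<beta>]])
  have 3: "subnerve A (image_family g \<beta>) = subnerve (f ` A) \<beta>"
    using subnerve_image_family[OF inj[OF g] border_cover_part[OF \<beta>] fA] by (simp only: gfD[OF A])
  have "g ` part \<beta> v \<subseteq> part \<alpha> (p v)" if "v \<in> index \<beta>" for v
  proof -
    have "p v \<in> index \<alpha>" "part \<beta> v \<subseteq> f ` part \<alpha> (p v)"
      using p that by (auto simp: refinement_projection_def)
    then show ?thesis using gfD[OF border_cover_part[OF \<alpha>]] by blast
  qed
  then have "refinement_projection \<alpha> (image_family g \<beta>) p"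
    using p by (simp add: refinement_projection_def)
  then show "\<exists>\<gamma>\<in>border_covers X A. refinement_projection \<alpha> \<gamma> p \<and> nerve \<gamma> \<subseteq> nerve \<beta> \<and>
      subnerve A \<gamma> \<subseteq> subnerve (f ` A) \<beta>"
    using 1 2 3 by blast
qed

section \<open>Directedness and nonemptiness of the two systems of covers\<close>

definition meet_family :: "'a family \<Rightarrow> 'a family \<Rightarrow> 'a family" where
  "meet_family \<alpha> \<beta> =
     \<lparr>index = prod_encode ` (index \<alpha> \<times> index \<beta>), subindex = prod_encode ` (subindex \<alpha> \<times> subindex \<beta>),
      part = \<lambda>k. part \<alpha> (fst (prod_decode k)) \<inter> part \<beta> (snd (prod_decode k))\<rparr>"

text \<open>Indices are natural numbers, so pairs of indices are coded by
  \<open>prod_encode\<close>; the refinement projections are the decoded components.\<close>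

lemma refined_by_meet_family:
  "refined_by \<alpha> (meet_family \<alpha> \<beta>)" "refined_by \<beta> (meet_family \<alpha> \<beta>)"
  unfolding refined_by_def
  by (rule exI[of _ "fst \<circ> prod_decode"], force simp: refinement_projection_def meet_family_def)
     (rule exI[of _ "snd \<circ> prod_decode"], force simp: refinement_projection_def meet_family_def)

lemma meet_family_parts:
  "(\<Union>v\<in>index (meet_family \<alpha> \<beta>). part (meet_family \<alpha> \<beta>) v) = (\<Union>v\<in>index \<alpha>. part \<alpha> v) \<inter> (\<Union>v\<in>index \<beta>. part \<beta> v)"
  "(\<Union>v\<in>subindex (meet_family \<alpha> \<beta>). part (meet_family \<alpha> \<beta>) v) = (\<Union>v\<in>subindex \<alpha>. part \<alpha> v) \<inter> (\<Union>v\<in>subindex \<beta>. part \<beta> v)"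
  by (auto simp: meet_family_def)

lemma finite_meet_family: "finite_family \<alpha> \<Longrightarrow> finite_family \<beta> \<Longrightarrow> finite_family (meet_family \<alpha> \<beta>)"
  by (auto simp: finite_family_def meet_family_def)

lemma openin_meet_family:
  "\<lbrakk>\<forall>v\<in>index \<alpha>. openin X (part \<alpha> v); \<forall>v\<in>index \<beta>. openin X (part \<beta> v)\<rbrakk>
   \<Longrightarrow> \<forall>v\<in>index (meet_family \<alpha> \<beta>). openin X (part (meet_family \<alpha> \<beta>) v)"
  by (auto simp: meet_family_def)

text \<open>The exceptional compact set of the meet is the union of those of the two covers.\<close>

lemma border_covers_directed:
  assumes "\<alpha> \<in> border_covers X A" "\<beta> \<in> border_covers X A"
  shows "\<exists>\<gamma>\<in>border_covers X A. refined_by \<alpha> \<gamma> \<and> refined_by \<beta> \<gamma>"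
proof -
  obtain K where K: "compactin X K" "topspace X - K = (\<Union>v\<in>index \<alpha>. part \<alpha> v)" "A - K \<subseteq> (\<Union>v\<in>subindex \<alpha>. part \<alpha> v)"
    using assms(1) by (auto simp: border_covers_def)
  obtain L where L: "compactin X L" "topspace X - L = (\<Union>v\<in>index \<beta>. part \<beta> v)" "A - L \<subseteq> (\<Union>v\<in>subindex \<beta>. part \<beta> v)"
    using assms(2) by (auto simp: border_covers_def)
  have "topspace X - (K \<union> L) = (\<Union>v\<in>index (meet_family \<alpha> \<beta>). part (meet_family \<alpha> \<beta>) v)"
    unfolding meet_family_parts K(2)[symmetric] L(2)[symmetric] by blast
  moreover have "A - (K \<union> L) \<subseteq> (\<Union>v\<in>subindex (meet_family \<alpha> \<beta>). part (meet_family \<alpha> \<beta>) v)"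
    unfolding meet_family_parts using K(3) L(3) by blast
  moreover have "finite_family (meet_family \<alpha> \<beta>)" "\<forall>v\<in>index (meet_family \<alpha> \<beta>). openin X (part (meet_family \<alpha> \<beta>) v)"
    using assms by (auto simp: border_covers_def intro!: finite_meet_family openin_meet_family[THEN bspec])
  ultimately have "meet_family \<alpha> \<beta> \<in> border_covers X A"
    using compactin_Un[OF K(1) L(1)] unfolding border_covers_def by blast
  then show ?thesis using refined_by_meet_family by blast
qed

lemma finite_open_covers_directed:
  assumes "\<alpha> \<in> finite_open_covers Y B" "\<beta> \<in> finite_open_covers Y B"
  shows "\<exists>\<gamma>\<in>finite_open_covers Y B. refined_by \<alpha> \<gamma> \<and> refined_by \<beta> \<gamma>"
proof -
  have "meet_family \<alpha> \<beta> \<in> finite_open_covers Y B"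
    using assms finite_meet_family[of \<alpha> \<beta>] openin_meet_family[of \<alpha> Y \<beta>]
    unfolding finite_open_covers_def mem_Collect_eq meet_family_parts by simp
  then show ?thesis using refined_by_meet_family by blast
qed

lemma border_covers_nonempty: "A \<subseteq> topspace X \<Longrightarrow> border_covers X A \<noteq> {}"
proof -
  assume "A \<subseteq> topspace X"
  then have "\<lparr>index = {0}, subindex = {0}, part = \<lambda>_. topspace X\<rparr> \<in> border_covers X A"
    by (auto simp: border_covers_def finite_family_def intro!: exI[of _ "{}"])
  then show ?thesis by blast
qed

lemma finite_open_covers_nonempty: "B \<subseteq> topspace Y \<Longrightarrow> finite_open_covers Y B \<noteq> {}"
proof -
  assume "B \<subseteq> topspace Y"
  then have "\<lparr>index = {0}, subindex = {0}, part = \<lambda>_. topspace Y\<rparr> \<in> finite_open_covers Y B"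
    by (auto simp: finite_open_covers_def finite_family_def)
  then show ?thesis by blast
qed

lemma (in comm_group) border_cohomology_nontrivial_iff:
  assumes "A \<subseteq> topspace X"
  shows "carrier (border_cohomology X A G n) \<noteq> {\<one>\<^bsub>border_cohomology X A G n\<^esub>} \<longleftrightarrow>
         (\<exists>\<alpha> c. persistent_cocycle (border_covers X A) A G n \<alpha> c)"
  unfolding border_cohomology_def
  by (rule limit_cohomology_nontrivial_iff[OF border_covers_nonempty[OF assms] border_covers_directed])

lemma (in comm_group) cech_cohomology_nontrivial_iff:
  assumes "B \<subseteq> topspace Y"
  shows "carrier (cech_cohomology Y B G n) \<noteq> {\<one>\<^bsub>cech_cohomology Y B G n\<^esub>} \<longleftrightarrow>
         (\<exists>\<alpha> c. persistent_cocycle (finite_open_covers Y B) B G n \<alpha> c)"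
  unfolding cech_cohomology_def
  by (rule limit_cohomology_nontrivial_iff[OF finite_open_covers_nonempty[OF assms] finite_open_covers_directed])

text \<open>A Urysohn function separating the preimages of \<open>C\<close> and \<open>D\<close> is
  a coordinate of the cube. This coordinate is continuous on the compactification, so the closures
  lie in its level sets for 0 and 1.\<close>

lemma stone_cech_pair_stone_cech:
  assumes "completely_regular_space X" "Hausdorff_space X" "normal_space X"
  shows "stone_cech_pair (stone_cech X) (stone_cech_embed X ` topspace X)"
proof
  let ?e = "stone_cech_embed X" and ?S = "stone_cech_embed X ` topspace X" and ?T = "stone_cech X"
  show "compact_space ?T" by (rule compact_space_stone_cech)
  show "Hausdorff_space ?T" by (rule Hausdorff_space_stone_cech)
  have hom: "homeomorphic_map X (subtopology ?T ?S) ?e"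
    using embedding_map_stone_cech[OF assms(1,2)] by (simp add: embedding_map_def)
  show ST: "?S \<subseteq> topspace ?T"
    using homeomorphic_imp_surjective_map[OF hom] unfolding topspace_subtopology by blast
  have "?S \<subseteq> unit_cube X closure_of ?S" using ST by (auto simp: stone_cech_def)
  then show "?T closure_of ?S = topspace ?T"
    unfolding stone_cech_def
    by (simp add: closure_of_subtopology Int_absorb1 closure_of_subset_topspace)
  fix C D assume CD: "closedin (subtopology ?T ?S) C" "closedin (subtopology ?T ?S) D" "C \<inter> D = {}"
  let ?C = "{x \<in> topspace X. ?e x \<in> C}" and ?D = "{x \<in> topspace X. ?e x \<in> D}"
  note preimage = closedin_continuous_map_preimage[OF homeomorphic_imp_continuous_map[OF hom]]
  have "disjnt ?C ?D" using CD(3) by (auto simp: disjnt_def)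
  from Urysohn_lemma[OF assms(3) preimage[OF CD(1)] preimage[OF CD(2)] this zero_le_one]
  obtain f :: "'a \<Rightarrow> real" where f: "continuous_map X (top_of_set {0..1}) f" "f ` ?C \<subseteq> {0}" "f ` ?D \<subseteq> {1}"
    by blast
  \<comment> \<open>The coordinates of the cube are indexed by extensional functions, hence the
    restriction.\<close>
  define h where "h = restrict f (topspace X)"
  have h: "h \<in> unit_functions X"
    using f(1) continuous_map_eq[of X _ f h] by (auto simp: unit_functions_def h_def)
  have proj: "continuous_map ?T (top_of_set {0..1}) (\<lambda>z. z h)"
    unfolding stone_cech_def unit_cube_def
    by (rule continuous_map_from_subtopology[OF continuous_map_product_projection[OF h]])
  have val: "?T closure_of E \<subseteq> {z \<in> topspace ?T. z h \<in> {r}}"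
    if E: "closedin (subtopology ?T ?S) E" "f ` {x \<in> topspace X. ?e x \<in> E} \<subseteq> {r}" "r \<in> {0..1}" for E r
  proof (rule closure_of_minimal)
    show "closedin ?T {z \<in> topspace ?T. z h \<in> {r}}"
      by (rule closedin_continuous_map_preimage[OF proj]) (use E(3) in \<open>auto simp: closedin_subtopology intro!: exI[of _ "{r}"]\<close>)
    show "E \<subseteq> {z \<in> topspace ?T. z h \<in> {r}}"
    proof
      fix z assume z: "z \<in> E"
      then have "z \<in> ?S" "z \<in> topspace ?T" using closedin_subset[OF E(1)] by auto
      then obtain x where x: "x \<in> topspace X" "z = ?e x" by blast
      then have "f x = r" using E(2) z by blast
      then have "z h = r" using x h by (simp add: stone_cech_embed_def h_def)
      then show "z \<in> {z \<in> topspace ?T. z h \<in> {r}}" using \<open>z \<in> topspace ?T\<close> by simp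
    qed
  qed
  show "?T closure_of C \<inter> ?T closure_of D = {}"
    using val[OF CD(1) f(2)] val[OF CD(2) f(3)] by force
qed

theorem theorem2p9:
  fixes X :: "'a topology" and G :: "('g, 'm) monoid_scheme"
  assumes "metrizable_space X"
    and "comm_group G"
  shows "border_large_cohomological_dim X G = large_cohomological_dim (stone_cech_remainder X) G"
proof -
  interpret comm_group G by (rule assms(2))
  let ?e = "stone_cech_embed X" and ?S = "stone_cech_embed X ` topspace X" and ?T = "stone_cech X"
  have creg: "completely_regular_space X" and haus: "Hausdorff_space X" and norm: "normal_space X"
    using assms(1) metrizable_imp_completely_regular_space metrizable_imp_Hausdorff_space metrizable_imp_normal_space by auto
  interpret stone_cech_pair ?T ?S by (rule stone_cech_pair_stone_cech[OF creg haus norm])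
  have hom: "homeomorphic_map X (subtopology ?T ?S) ?e"
    using embedding_map_stone_cech[OF creg haus] by (simp add: embedding_map_def)
  then obtain g where eg: "homeomorphic_maps X (subtopology ?T ?S) ?e g"
    unfolding homeomorphic_map_maps ..
  then have ge: "homeomorphic_maps (subtopology ?T ?S) X g ?e" by (rule homeomorphic_maps_sym[THEN iffD1])
  have metr: "metrizable_space (subtopology ?T ?S)"
    using assms(1) homeomorphic_metrizable_space[OF homeomorphic_map_imp_homeomorphic_space[OF hom]] by blast
  \<comment> \<open>Both dimensions are suprema of degrees, so it is enough that the same degrees
    \<open>n\<close> occur; the closed sets on the two sides need not correspond one to one.\<close>
  have "(\<exists>A. closedin X A \<and> (\<exists>\<alpha> c. persistent_cocycle (border_covers X A) A G n \<alpha> c)) \<longleftrightarrow>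
      (\<exists>B. closedin remainder B \<and> (\<exists>\<alpha> c. persistent_cocycle (finite_open_covers remainder B) B G n \<alpha> c))"
    (is "?l \<longleftrightarrow> ?r") for n
  proof
    assume ?l
    then obtain A \<alpha> c where A: "closedin X A" and pers: "persistent_cocycle (border_covers X A) A G n \<alpha> c" by blast
    have cl: "closedin (subtopology ?T ?S) (?e ` A)"
      using homeomorphic_map_closedness[OF hom closedin_subset[OF A]] A by blast
    have "closedin remainder (?T closure_of (?e ` A) - ?S)"
    proof -
      have "?T closure_of (?e ` A) - ?S = ?T closure_of (?e ` A) \<inter> (topspace ?T - ?S)"
        using closure_of_subset_topspace[of ?T "?e ` A"] by blast
      then show ?thesis unfolding closedin_subtopology by (intro exI[of _ "?T closure_of (?e ` A)"]) simp
    qed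
    then show ?r
      using persistent_ext_family[OF assms(2) metr cl persistent_image_family[OF eg closedin_subset[OF A] pers]] by blast
  next
    assume ?r
    then obtain B \<alpha> c where B: "closedin remainder B" and "persistent_cocycle (finite_open_covers remainder B) B G n \<alpha> c" by blast
    from persistent_lift[OF assms(2) metr this] obtain A \<alpha>' c'
      where A: "closedin (subtopology ?T ?S) A" and pers: "persistent_cocycle (border_covers (subtopology ?T ?S) A) A G n \<alpha>' c'" by blast
    have "closedin X (g ` A)"
      using ge A homeomorphic_map_closedness[of "subtopology ?T ?S" X g A] closedin_subset[OF A]
      by (simp only: homeomorphic_maps_map)
    then show ?l
      using persistent_image_family[OF ge closedin_subset[OF A] pers] by blast
  qed
  \<comment> \<open>Closed sets lie in the space, so their systems of covers are nonempty and
    nontriviality amounts to a persistent cocycle.\<close>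
  then have "(\<exists>A. closedin X A \<and> carrier (border_cohomology X A G n) \<noteq> {\<one>\<^bsub>border_cohomology X A G n\<^esub>}) \<longleftrightarrow>
      (\<exists>B. closedin remainder B \<and> carrier (cech_cohomology remainder B G n) \<noteq> {\<one>\<^bsub>cech_cohomology remainder B G n\<^esub>})" for n
    by (simp only: border_cohomology_nontrivial_iff[OF closedin_subset] cech_cohomology_nontrivial_iff[OF closedin_subset]
        cong: conj_cong)
  then show ?thesis
    by (simp add: border_large_cohomological_dim_def large_cohomological_dim_def stone_cech_remainder_def)
qed

end
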